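(* Consider two even tensors $\mathcal A$ and $\mathcal B$ in graded canonical form, with diagonal parity operators on the auxiliary space $Z_a$, $Z_b$. If they generate the same fermionic matrix product state with antiperiodic boundary conditions for all $N$, then: (i) the dimensions of the matrices $A^i$ and $B^i$ coincide; (ii) there exist an invertible matrix $X$ and a permutation matrix $\Pi$ such that $A^i=X\,\Pi\,B^i\,\Pi^{-1}X^{-1}$ for all $i$, and $[X,Z_a]=0$.
   Context: The local physical space is $\mathbb Z_2$-graded of dimension $d$ with homogeneous orthonormal basis labelled by $n$, of parity $|n|\in\{0,1\}$. An even tensor $\mathcal A$ consists of complex $D\times D$ matrices $A^n$ and a diagonal parity matrix $Z$ with entries $\pm1$ on the auxiliary space $\mathbb C^D$ such that $ZA^n=(-1)^{|n|}A^nZ$ for all $n$. The fMPS with antiperiodic boundary conditions it generates is the vector of the $N$-site chain with coefficients $c_{n_1,\dots,n_N}=\mathrm{tr}(A^{n_1}\cdots A^{n_N})$ in the product basis $|n_1,\dots,n_N\rangle$. The transfer matrix of $\mathcal A$ is $E=\sum_nA^n\otimes\overline{A^n}$. A subspace $W$ of the auxiliary space is graded if its orthogonal projector commutes with $Z$. An even tensor is a graded normal tensor (GNT) if there is no nontrivial proper graded subspace invariant under all $A^n$ and the transfer matrix has spectral radius $1$ and, counted with multiplicity, either exactly one (non-degenerate) or exactly two (degenerate) eigenvalues of modulus $1$, all equal to $1$. An even tensor is in graded canonical form (GCF) if $A^n=\bigoplus_{k=1}^r\mu_kA_k^n$ with $\mu_k\in\mathbb C$, the parity $Z$ has the same block structure,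 and each block tensor $\mathcal A_k=(A_k^n)_n$ is a GNT. Standing convention: identically vanishing auxiliary indices are removed, i.e. there is no $\alpha$ with $A^n_{\alpha,\beta}=A^n_{\beta,\alpha}=0$ for all $n,\beta$ (so all $\mu_k\neq0$). *)

theory Defs
  imports "Jordan_Normal_Form.Spectral_Radius" "Jordan_Normal_Form.Schur_Decomposition"
    "Jordan_Normal_Form.VS_Connect"
begin

text \<open>
  The local physical basis is indexed by a finite type \<open>'n\<close>, so that \<open>d\<close> is its cardinality, and
  \<open>par n\<close> is the parity of the basis vector labelled by \<open>n\<close>. A tensor is a family
  \<open>A :: 'n \<Rightarrow> complex mat\<close> of \<open>D\<close> by \<open>D\<close> matrices (matrices of Jordan_Normal_Form carry
  their dimension as data, which is needed because the bond dimensions of two tensors are compared).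
\<close>

definition even_tensor ::
  "('n::finite \<Rightarrow> nat) \<Rightarrow> nat \<Rightarrow> ('n \<Rightarrow> complex mat) \<Rightarrow> complex mat \<Rightarrow> bool" where
  "even_tensor par D A Z \<longleftrightarrow>
     (\<forall>n. A n \<in> carrier_mat D D) \<and>
     Z \<in> carrier_mat D D \<and> diagonal_mat Z \<and> (\<forall>i<D. Z $$ (i, i) \<in> {1, -1}) \<and>
     (\<forall>n. Z * A n = (-1) ^ par n \<cdot>\<^sub>m (A n * Z))"

definition mat_trace :: "complex mat \<Rightarrow> complex" where
  "mat_trace M = (\<Sum>i<dim_row M. M $$ (i, i))"

text \<open>
  The vector generated on the \<open>N\<close>-site chain is given by its coefficients in the product basis;
  the basis is indexed by the words \<open>[n\<^sub>1, \<dots>, n\<^sub>N]\<close> of length \<open>N\<close>.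
\<close>

definition fMPS_apbc ::
  "nat \<Rightarrow> ('n::finite \<Rightarrow> complex mat) \<Rightarrow> nat \<Rightarrow> 'n list \<Rightarrow> complex" where
  "fMPS_apbc D A N = (\<lambda>ns. if length ns = N
     then mat_trace (foldr (\<lambda>n M. A n * M) ns (1\<^sub>m D)) else 0)"

definition kronecker :: "complex mat \<Rightarrow> complex mat \<Rightarrow> complex mat" where
  "kronecker M N = mat (dim_row M * dim_row N) (dim_col M * dim_col N)
     (\<lambda>(i, j). M $$ (i div dim_row N, j div dim_col N) * N $$ (i mod dim_row N, j mod dim_col N))"

definition transfer_matrix :: "nat \<Rightarrow> ('n::finite \<Rightarrow> complex mat) \<Rightarrow> complex mat" where
  "transfer_matrix D A = mat (D * D) (D * D)
     (\<lambda>ij. \<Sum>n\<in>UNIV. kronecker (A n) (map_mat cnj (A n)) $$ ij)"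

definition orthogonal_projector :: "nat \<Rightarrow> complex vec set \<Rightarrow> complex mat \<Rightarrow> bool" where
  "orthogonal_projector D W P \<longleftrightarrow>
     P \<in> carrier_mat D D \<and> P * P = P \<and> mat_adjoint P = P \<and>
     (\<lambda>v. P *\<^sub>v v) ` carrier_vec D = W"

definition graded_subspace :: "nat \<Rightarrow> complex mat \<Rightarrow> complex vec set \<Rightarrow> bool" where
  "graded_subspace D Z W \<longleftrightarrow>
     VectorSpace.subspace class_ring W (module_vec TYPE(complex) D) \<and>
     (\<exists>P. orthogonal_projector D W P \<and> P * Z = Z * P)"

definition invariant_subspace :: "('n::finite \<Rightarrow> complex mat) \<Rightarrow> complex vec set \<Rightarrow> bool" where
  "invariant_subspace A W \<longleftrightarrow> (\<forall>n. \<forall>w\<in>W. A n *\<^sub>v w \<in> W)"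

definition peripheral_eigenvalues :: "complex mat \<Rightarrow> complex set" where
  "peripheral_eigenvalues E = {e. eigenvalue E e \<and> cmod e = 1}"

text \<open>
  Eigenvalues are counted with algebraic multiplicity, that is, with their order as roots of the
  characteristic polynomial. The count excludes \<open>D = 0\<close>, for which \<open>spectral_radius\<close>
  is unspecified.
\<close>

definition graded_normal_tensor ::
  "('n::finite \<Rightarrow> nat) \<Rightarrow> nat \<Rightarrow> ('n \<Rightarrow> complex mat) \<Rightarrow> complex mat \<Rightarrow> bool" where
  "graded_normal_tensor par D A Z \<longleftrightarrow>
     even_tensor par D A Z \<and>
     (\<forall>W. graded_subspace D Z W \<and> invariant_subspace A W
        \<longrightarrow> W = {0\<^sub>v D} \<or> W = carrier_vec D) \<and>
     (let E = transfer_matrix D A in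
        spectral_radius E = 1 \<and>
        (\<Sum>e\<in>peripheral_eigenvalues E. order e (char_poly E)) \<in> {1, 2} \<and>
        (\<forall>e\<in>peripheral_eigenvalues E. e = 1))"

definition graded_canonical_form ::
  "('n::finite \<Rightarrow> nat) \<Rightarrow> nat \<Rightarrow> ('n \<Rightarrow> complex mat) \<Rightarrow> complex mat \<Rightarrow> bool" where
  "graded_canonical_form par D A Z \<longleftrightarrow>
     even_tensor par D A Z \<and>
     (\<exists>(r::nat) (\<mu> :: nat \<Rightarrow> complex) Dk Ak Zk.
        (\<forall>k<r. graded_normal_tensor par (Dk k) (Ak k) (Zk k)) \<and>
        (\<forall>n. A n = diag_block_mat (map (\<lambda>k. \<mu> k \<cdot>\<^sub>m Ak k n) [0..<r])) \<and>
        Z = diag_block_mat (map Zk [0..<r]))"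

definition no_vanishing_index :: "nat \<Rightarrow> ('n::finite \<Rightarrow> complex mat) \<Rightarrow> bool" where
  "no_vanishing_index D A \<longleftrightarrow>
     \<not> (\<exists>\<alpha><D. \<forall>n. \<forall>\<beta><D. A n $$ (\<alpha>, \<beta>) = 0 \<and> A n $$ (\<beta>, \<alpha>) = 0)"

definition permutation_matrix :: "nat \<Rightarrow> complex mat \<Rightarrow> bool" where
  "permutation_matrix D P \<longleftrightarrow>
     (\<exists>\<pi>. \<pi> permutes {..<D} \<and> P = mat D D (\<lambda>(i, j). if i = \<pi> j then 1 else 0))"

definition inverse_matrices :: "nat \<Rightarrow> complex mat \<Rightarrow> complex mat \<Rightarrow> bool" where
  "inverse_matrices D M M' \<longleftrightarrow>
     M \<in> carrier_mat D D \<and> M' \<in> carrier_mat D D \<and> inverts_mat M M' \<and> inverts_mat M' M"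

end

theory Submission
  imports Defs "HOL-Combinatorics.Permutations"
begin

text \<open>Adjoining to a block \<open>A\<^sub>k\<close> the matrices \<open>A\<^sub>k\<^sup>n Z\<^sub>k\<close> turns graded irreducibility into ordinary
  irreducibility. The chain only determines the traces of words in the \<open>A\<^sup>n\<close>, but the trace of an
  extended word, summed over a block and its copy with \<open>Z\<^sub>k\<close> replaced by \<open>-Z\<^sub>k\<close>, is either zero or a
  universal multiple of such a trace. Separating inequivalent irreducible families by noncommutative
  polynomials (Burnside) therefore matches the blocks of the two tensors up to the sign of \<open>Z\<^sub>k\<close>.
  Hence \<open>A\<^sup>n = T B\<^sup>n T\<^sup>-\<^sup>1\<close> and \<open>Z\<^sub>a = T Y T\<^sup>-\<^sup>1\<close>, where \<open>Y\<close> is \<open>Z\<^sub>b\<close> up to one sign per block. The diagonal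
  sign matrices \<open>Z\<^sub>a\<close> and \<open>Y\<close> have the same trace, so a permutation matrix \<open>\<Pi>\<close> conjugates \<open>Y\<close> to
  \<open>Z\<^sub>a\<close>, and \<open>X = T \<Pi>\<^sup>-\<^sup>1\<close> commutes with \<open>Z\<^sub>a\<close>.\<close>

section \<open>Subspaces and orthogonal projectors\<close>

text \<open>The parity operators have to enter the argument because the matrices \<open>A^n\<close>
  of a degenerate block may be reducible in the ordinary sense; traces of their words alone would
  identify only pieces that forget the grading. Two obstacles shape how they enter. Chains of length
  at least 1 do not give the trace of the empty word, that is the bond dimension; hence all
  polynomials below lack a constant term, and the generated algebras are not assumed to be unital.
  Nor do they give the trace of a word with an odd number of parity operators; hence each block is
  accompanied by its copy of opposite parity, in which these traces cancel. The price is an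
  undetermined sign per block, which may exchange the roles of even and odd basis vectors there. The
  permutation matrix compensates for exactly this: it rearranges single basis vectors, while any
  reordering of whole blocks is already part of the intertwiner \<open>T\<close>.\<close>

definition lin_subspace :: "nat \<Rightarrow> complex vec set \<Rightarrow> bool" where
  "lin_subspace D W \<longleftrightarrow> W \<subseteq> carrier_vec D \<and> 0\<^sub>v D \<in> W \<and>
     (\<forall>v\<in>W. \<forall>w\<in>W. v + w \<in> W) \<and> (\<forall>c. \<forall>v\<in>W. c \<cdot>\<^sub>v v \<in> W)"

lemma lin_subspaceD:
  assumes "lin_subspace D W"
  shows "v \<in> W \<Longrightarrow> v \<in> carrier_vec D" and "0\<^sub>v D \<in> W"
    and "v \<in> W \<Longrightarrow> w \<in> W \<Longrightarrow> v + w \<in> W" and "v \<in> W \<Longrightarrow> c \<cdot>\<^sub>v v \<in> W"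
  using assms unfolding lin_subspace_def by auto

lemma lin_subspace_minus:
  assumes "lin_subspace D W" "v \<in> W" "w \<in> W"
  shows "v - w \<in> W"
proof -
  have "v - w = v + (-1) \<cdot>\<^sub>v w"
    using lin_subspaceD(1)[OF assms(1)] assms(2,3) by (intro eq_vecI) auto
  thus ?thesis using assms by (simp add: lin_subspaceD)
qed

section \<open>Elementary identities and rank-one matrices\<close>

lemma smult_mat_mult_vec:
  "A \<in> carrier_mat m n \<Longrightarrow> v \<in> carrier_vec n \<Longrightarrow> (c \<cdot>\<^sub>m A) *\<^sub>v v = c \<cdot>\<^sub>v (A *\<^sub>v (v :: complex vec))"
  by (intro eq_vecI) auto

lemma mat_eq_by_vec:
  assumes "A \<in> carrier_mat m n" "B \<in> carrier_mat m n"
    and "\<And>v. v \<in> carrier_vec n \<Longrightarrow> A *\<^sub>v v = B *\<^sub>v (v :: complex vec)"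
  shows "A = B"
proof (rule eq_matI)
  fix i j assume "i < dim_row B" "j < dim_col B"
  hence ij: "i < m" "j < n" using assms by auto
  have "(A *\<^sub>v unit_vec n j) $ i = (B *\<^sub>v unit_vec n j) $ i" using assms(3) by simp
  thus "A $$ (i, j) = B $$ (i, j)" using assms(1,2) ij by simp
qed (use assms in auto)

lemma smult_smult_mat: "a \<cdot>\<^sub>m (b \<cdot>\<^sub>m A) = (a * b) \<cdot>\<^sub>m (A :: complex mat)"
  by (intro eq_matI) auto

lemma one_smult_mat [simp]: "1 \<cdot>\<^sub>m A = (A :: complex mat)"
  by (intro eq_matI) auto

lemma smult_zero_vec_carrier [simp]: "c \<cdot>\<^sub>v 0\<^sub>v n = (0\<^sub>v n :: complex vec)"
  by (intro eq_vecI) auto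

lemma zero_mat_mult_vec [simp]:
  "v \<in> carrier_vec n \<Longrightarrow> 0\<^sub>m m n *\<^sub>v v = (0\<^sub>v m :: complex vec)"
  by (intro eq_vecI) auto

lemma mat_mult_zero_vec [simp]:
  "A \<in> carrier_mat m n \<Longrightarrow> A *\<^sub>v 0\<^sub>v n = (0\<^sub>v m :: complex vec)"
  by (intro eq_vecI) auto

text \<open>The rank-one matrix \<open>u v^T\<close>, without complex conjugation: products contract
  through the bilinear \<open>\<bullet>\<close>, and a Hermitian projector needs an explicit
  \<open>conjugate\<close>.\<close>

definition outer :: "complex vec \<Rightarrow> complex vec \<Rightarrow> complex mat" where
  "outer u v = mat (dim_vec u) (dim_vec v) (\<lambda>(i, j). u $ i * v $ j)"

lemma outer_carrier [simp]:
  "u \<in> carrier_vec m \<Longrightarrow> v \<in> carrier_vec n \<Longrightarrow> outer u v \<in> carrier_mat m n"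
  unfolding outer_def by auto

lemma mult_outer:
  assumes "A \<in> carrier_mat k m" "u \<in> carrier_vec m"
  shows "A * outer u v = outer (A *\<^sub>v u) v"
  using assms by (intro eq_matI)
    (auto simp: outer_def scalar_prod_def sum_distrib_right mult.assoc intro!: sum.cong)

lemma outer_mult:
  assumes "A \<in> carrier_mat m n" "v \<in> carrier_vec m"
  shows "outer u v * A = outer u (A\<^sup>T *\<^sub>v v)"
  using assms by (intro eq_matI)
    (auto simp: outer_def scalar_prod_def sum_distrib_left ac_simps intro!: sum.cong)

lemma outer_mult_vec:
  assumes "v \<in> carrier_vec n" "w \<in> carrier_vec n"
  shows "outer u v *\<^sub>v w = (v \<bullet> w) \<cdot>\<^sub>v u"
  using assms by (intro eq_vecI)
    (auto simp: outer_def scalar_prod_def sum_distrib_left sum_distrib_right ac_simps intro!: sum.cong)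

lemma outer_mult_outer:
  assumes "v \<in> carrier_vec n" "w \<in> carrier_vec n"
  shows "outer u v * outer w x = (v \<bullet> w) \<cdot>\<^sub>m outer u x"
  using assms by (intro eq_matI)
    (auto simp: outer_def scalar_prod_def sum_distrib_left sum_distrib_right ac_simps intro!: sum.cong)

lemma outer_zero: "outer (0\<^sub>v m) (v :: complex vec) = 0\<^sub>m m (dim_vec v)"
  "outer (v :: complex vec) (0\<^sub>v m) = 0\<^sub>m (dim_vec v) m"
  by (auto simp: outer_def)

section \<open>Traces, adjoints and orthogonal projectors\<close>

lemma mat_trace_add:
  "A \<in> carrier_mat n n \<Longrightarrow> B \<in> carrier_mat n n \<Longrightarrow> mat_trace (A + B) = mat_trace A + mat_trace B"
  unfolding mat_trace_def by (simp add: sum.distrib)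

lemma mat_trace_smult:
  "A \<in> carrier_mat n n \<Longrightarrow> mat_trace (c \<cdot>\<^sub>m A) = c * mat_trace A"
  unfolding mat_trace_def by (simp add: sum_distrib_left)

lemma mat_trace_zero [simp]: "mat_trace (0\<^sub>m n n) = 0"
  unfolding mat_trace_def by simp

lemma mat_trace_comm:
  assumes "A \<in> carrier_mat m n" "B \<in> carrier_mat n m"
  shows "mat_trace (A * B) = mat_trace (B * A)"
proof -
  have "mat_trace (A * B) = (\<Sum>i<m. \<Sum>j<n. A $$ (i, j) * B $$ (j, i))"
    using assms by (auto simp: mat_trace_def scalar_prod_def atLeast0LessThan intro!: sum.cong)
  also have "\<dots> = (\<Sum>j<n. \<Sum>i<m. B $$ (j, i) * A $$ (i, j))"
    by (subst sum.swap) (simp add: mult.commute)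
  also have "\<dots> = mat_trace (B * A)"
    using assms by (auto simp: mat_trace_def scalar_prod_def atLeast0LessThan intro!: sum.cong)
  finally show ?thesis .
qed

lemma mat_trace_outer:
  "u \<in> carrier_vec n \<Longrightarrow> v \<in> carrier_vec n \<Longrightarrow> mat_trace (outer u v) = v \<bullet> u"
  by (auto simp: mat_trace_def outer_def scalar_prod_def atLeast0LessThan mult.commute intro!: sum.cong)

lemma mat_adjoint_alt:
  "mat_adjoint (A :: complex mat) = mat (dim_col A) (dim_row A) (\<lambda>(i, j). cnj (A $$ (j, i)))"
  by (rule eq_matI) (auto simp: mat_adjoint_def mat_of_rows_def)

lemma hermitian_index:
  assumes "mat_adjoint P = (P :: complex mat)" "P \<in> carrier_mat n n" "i < n" "j < n"
  shows "cnj (P $$ (i, j)) = P $$ (j, i)"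
proof -
  have "mat_adjoint P $$ (j, i) = cnj (P $$ (i, j))"
    unfolding mat_adjoint_alt using assms(2-) by simp
  thus ?thesis unfolding assms(1) by simp
qed

text \<open>For a Hermitian idempotent each diagonal entry is the squared norm of its row; hence it
  dominates its own square and is at most 1.\<close>

lemma projector_trace_le:
  assumes P: "P \<in> carrier_mat D D" and PP: "P * P = P" and adj: "mat_adjoint P = P"
  shows "Re (mat_trace P) \<le> D"
proof -
  have "Re (P $$ (i, i)) \<le> 1" if i: "i < D" for i
  proof -
    have "P $$ (i, i) = (\<Sum>j<D. P $$ (i, j) * P $$ (j, i))"
      using arg_cong[OF PP, of "\<lambda>X. X $$ (i, i)"] P i
      by (simp add: scalar_prod_def atLeast0LessThan)
    also have "\<dots> = (\<Sum>j<D. of_real ((cmod (P $$ (i, j)))\<^sup>2))"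
      using hermitian_index[OF adj P] i
      by (intro sum.cong refl) (simp add: complex_norm_square flip: of_real_power)
    finally have eq: "Re (P $$ (i, i)) = (\<Sum>j<D. (cmod (P $$ (i, j)))\<^sup>2)" by simp
    have "(Re (P $$ (i, i)))\<^sup>2 \<le> (cmod (P $$ (i, i)))\<^sup>2"
      by (simp add: cmod_power2)
    also have "\<dots> \<le> Re (P $$ (i, i))"
      unfolding eq using i by (intro member_le_sum) auto
    finally have "Re (P $$ (i, i)) * Re (P $$ (i, i)) \<le> 1 * Re (P $$ (i, i))"
      by (simp add: power2_eq_square)
    thus ?thesis by (metis dual_order.trans linorder_linear mult_le_cancel_right order_le_less zero_le_one)
  qed
  hence "(\<Sum>i<D. Re (P $$ (i, i))) \<le> (\<Sum>i<D. 1)" by (intro sum_mono) auto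
  thus ?thesis using P by (simp add: mat_trace_def)
qed

lemma scalar_prod_cnj_self:
  "u \<in> carrier_vec n \<Longrightarrow> conjugate u \<bullet> (u :: complex vec) = 0 \<Longrightarrow> u = 0\<^sub>v n"
  using conjugate_square_eq_0_vec[of u n] comm_scalar_prod[of u n "conjugate u"] by simp

text \<open>The projector is built by adjoining one orthogonal vector at a time. Each step raises the
  trace by one, and the trace is at most the dimension, so the process stops.\<close>

lemma ex_orthogonal_projector:
  assumes W: "lin_subspace D W"
  shows "\<exists>P. orthogonal_projector D W P"
proof (rule ccontr)
  assume no: "\<not> ?thesis"
  \<comment> \<open>Orthogonal projectors with range inside \<open>W\<close>; a range equal to
    \<open>W\<close> is what the assumption rules out.\<close>
  define Q where "Q P \<longleftrightarrow> P \<in> carrier_mat D D \<and> P * P = P \<and> mat_adjoint P = P \<and>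
    (\<forall>v\<in>carrier_vec D. P *\<^sub>v v \<in> W)" for P
  note WD = lin_subspaceD[OF W]
  have step: "\<exists>P'. Q P' \<and> mat_trace P' = mat_trace P + 1" if "Q P" for P
  proof -
    have P: "P \<in> carrier_mat D D" "P * P = P" "mat_adjoint P = P"
      "\<And>v. v \<in> carrier_vec D \<Longrightarrow> P *\<^sub>v v \<in> W" using that unfolding Q_def by auto
    have "\<exists>w\<in>W. P *\<^sub>v w \<noteq> w"
    proof (rule ccontr)
      assume "\<not> ?thesis"
      hence "(\<lambda>v. P *\<^sub>v v) ` carrier_vec D = W"
        using P(4) WD(1) by (metis (no_types, lifting) image_subset_iff subsetI subset_antisym imageI)
      thus False using no P unfolding orthogonal_projector_def by auto
    qed
    then obtain w where w: "w \<in> W" "P *\<^sub>v w \<noteq> w" by auto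
    have wc: "w \<in> carrier_vec D" using WD(1) w by auto
    \<comment> \<open>The part of \<open>w\<close> orthogonal to the range of \<open>P\<close>. It
      lies in \<open>W\<close>, and is nonzero because \<open>P\<close> does not fix
      \<open>w\<close>.\<close>
    define u where "u = w - P *\<^sub>v w"
    have uW: "u \<in> W" unfolding u_def using w P(4)[OF wc] W by (intro lin_subspace_minus)
    hence uc: "u \<in> carrier_vec D" using WD by auto
    have u0: "u \<noteq> 0\<^sub>v D"
    proof
      assume u0: "u = 0\<^sub>v D"
      have "w = u + P *\<^sub>v w" unfolding u_def using wc P(1) by (intro eq_vecI) auto
      thus False using u0 w(2) wc P(1) by auto
    qed
    have Pu: "P *\<^sub>v u = 0\<^sub>v D"
    proof -
      have "P *\<^sub>v u = P *\<^sub>v w - P *\<^sub>v (P *\<^sub>v w)"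
        unfolding u_def using P(1) wc by (intro mult_minus_distrib_mat_vec) auto
      also have "P *\<^sub>v (P *\<^sub>v w) = P *\<^sub>v w"
        using P(1,2) wc by (metis assoc_mult_mat_vec)
      finally show ?thesis using P(1) wc by simp
    qed
    have PTu: "P\<^sup>T *\<^sub>v conjugate u = 0\<^sub>v D"
    proof (rule eq_vecI)
      fix i assume "i < dim_vec (0\<^sub>v D)"
      hence i: "i < D" by simp
      have "(P\<^sup>T *\<^sub>v conjugate u) $ i = (\<Sum>j<D. P $$ (j, i) * cnj (u $ j))"
        using P(1) uc i by (simp add: scalar_prod_def atLeast0LessThan)
      also have "\<dots> = cnj (\<Sum>j<D. P $$ (i, j) * u $ j)"
        using hermitian_index[OF P(3,1)] i by simp
      also have "(\<Sum>j<D. P $$ (i, j) * u $ j) = (P *\<^sub>v u) $ i"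
        using P(1) uc i by (simp add: scalar_prod_def atLeast0LessThan)
      finally show "(P\<^sup>T *\<^sub>v conjugate u) $ i = 0\<^sub>v D $ i" using Pu i by simp
    qed (use P uc in auto)
    define c where "c = conjugate u \<bullet> u"
    have c0: "c \<noteq> 0" unfolding c_def using u0 uc scalar_prod_cnj_self by blast
    have cu: "conjugate u \<in> carrier_vec D" using uc by simp
    have cre: "cnj c = c" unfolding c_def using uc by (simp add: scalar_prod_def mult.commute)
    \<comment> \<open>The orthogonal projector onto the line of \<open>u\<close>, of trace 1. Its
      products with \<open>P\<close> vanish on both sides, so \<open>P + R\<close> is again an
      orthogonal projector.\<close>
    define R where "R = (1 / c) \<cdot>\<^sub>m outer u (conjugate u)"
    have R: "R \<in> carrier_mat D D" unfolding R_def using uc cu by simp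
    have RR: "R * R = R"
    proof -
      have o: "outer u (conjugate u) \<in> carrier_mat D D" using uc cu by simp
      have "R * R = (1 / c) \<cdot>\<^sub>m ((1 / c) \<cdot>\<^sub>m (outer u (conjugate u) * outer u (conjugate u)))"
        unfolding R_def using o by (simp add: mult_smult_distrib[OF o o] mult_smult_assoc_mat[OF o smult_carrier_mat[OF o]])
      also have "\<dots> = R" unfolding outer_mult_outer[OF cu uc] R_def c_def[symmetric]
        using c0 o by (intro eq_matI) auto
      finally show ?thesis .
    qed
    have PR: "P * R = 0\<^sub>m D D"
      unfolding R_def using P(1) uc cu Pu
      by (simp add: mult_smult_distrib[of _ D D _ D] mult_outer[of _ D D] outer_zero)
    have RP: "R * P = 0\<^sub>m D D"
      unfolding R_def using P(1) uc cu PTu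
      by (simp add: mult_smult_assoc_mat[of _ D D _ D] outer_mult[of _ D D] outer_zero)
    have adjR: "cnj (R $$ (i, j)) = R $$ (j, i)" if "i < D" "j < D" for i j
      using that uc cre unfolding R_def by (simp add: outer_def)
    have "Q (P + R)" unfolding Q_def
    proof (intro conjI ballI)
      show "(P + R) * (P + R) = P + R"
        using P(1,2) R RR PR RP
        by (simp add: add_mult_distrib_mat[of _ D D _ _ D] mult_add_distrib_mat[of _ D D _ D])
      show "mat_adjoint (P + R) = P + R"
        using adjR hermitian_index[OF P(3,1)] P(1) R
        by (intro eq_matI) (auto simp: mat_adjoint_alt)
      show "(P + R) *\<^sub>v v \<in> W" if v: "v \<in> carrier_vec D" for v
      proof -
        have "R *\<^sub>v v = (1 / c * (conjugate u \<bullet> v)) \<cdot>\<^sub>v u"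
          unfolding R_def using outer_mult_vec[OF cu v, of u] uc cu v
          by (simp add: smult_smult_assoc smult_mat_mult_vec[of _ D D])
        hence "R *\<^sub>v v \<in> W" using WD(4) uW by simp
        thus ?thesis using P(1,4) R v WD(3) by (simp add: add_mult_distrib_mat_vec[of _ D D])
      qed
    qed (use P R in auto)
    moreover have "mat_trace (P + R) = mat_trace P + 1"
      unfolding mat_trace_add[OF P(1) R]
      unfolding R_def using uc cu c0 by (simp add: mat_trace_smult[of _ D] mat_trace_outer c_def)
    ultimately show ?thesis by blast
  qed
  have "\<exists>P. Q P \<and> mat_trace P = of_nat n" for n
  proof (induction n)
    case 0
    have "Q (0\<^sub>m D D)" unfolding Q_def using WD(2) by (auto simp: mat_adjoint_alt)
    thus ?case using mat_trace_zero by fastforce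
  next
    case (Suc n)
    thus ?case using step by fastforce
  qed
  \<comment> \<open>One more than the trace of a projector in dimension \<open>D\<close> can
    be.\<close>
  then obtain P where "Q P" "mat_trace P = of_nat (Suc D)" by blast
  thus False using projector_trace_le[of P D] unfolding Q_def by auto
qed

text \<open>Annihilation is meant in the bilinear sense. For \<open>x\<close> outside
  \<open>W\<close> and \<open>P\<close> the orthogonal projector onto \<open>W\<close>, the
  conjugate of \<open>x - P x\<close> would be a nonzero annihilator.\<close>

lemma subspace_eq_carrier:
  assumes W: "lin_subspace D W"
    and ann: "\<And>v. v \<in> carrier_vec D \<Longrightarrow> (\<And>w. w \<in> W \<Longrightarrow> w \<bullet> v = 0) \<Longrightarrow> v = 0\<^sub>v D"
  shows "W = carrier_vec D"
proof (rule ccontr)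
  assume ne: "W \<noteq> carrier_vec D"
  note WD = lin_subspaceD[OF W]
  obtain P where P: "P \<in> carrier_mat D D" "P * P = P" "mat_adjoint P = P"
    "(\<lambda>v. P *\<^sub>v v) ` carrier_vec D = W"
    using ex_orthogonal_projector[OF W] unfolding orthogonal_projector_def by auto
  obtain x where x: "x \<in> carrier_vec D" "x \<notin> W" using ne WD(1) by auto
  define u where "u = x - P *\<^sub>v x"
  have uc: "u \<in> carrier_vec D" unfolding u_def using x P by simp
  have Pu: "P *\<^sub>v u = 0\<^sub>v D"
  proof -
    have "P *\<^sub>v u = P *\<^sub>v x - P *\<^sub>v (P *\<^sub>v x)"
      unfolding u_def using P(1) x by (intro mult_minus_distrib_mat_vec) auto
    also have "P *\<^sub>v (P *\<^sub>v x) = P *\<^sub>v x" using P(1,2) x by (metis assoc_mult_mat_vec)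
    finally show ?thesis using P(1) x by simp
  qed
  have "w \<bullet> conjugate u = 0" if "w \<in> W" for w
  proof -
    obtain v where v: "v \<in> carrier_vec D" "w = P *\<^sub>v v"
      using \<open>w \<in> W\<close> unfolding P(4)[symmetric] by (rule imageE)
    have "w \<bullet> conjugate u = (\<Sum>i<D. \<Sum>j<D. P $$ (i, j) * v $ j * cnj (u $ i))"
      unfolding v(2) using P(1) v(1) uc
      by (auto simp: scalar_prod_def atLeast0LessThan sum_distrib_right intro!: sum.cong)
    also have "\<dots> = (\<Sum>j<D. \<Sum>i<D. P $$ (i, j) * v $ j * cnj (u $ i))" by (rule sum.swap)
    also have "\<dots> = (\<Sum>j<D. v $ j * cnj ((P *\<^sub>v u) $ j))"
      using P(1) uc hermitian_index[OF P(3,1)]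
      by (auto simp: scalar_prod_def atLeast0LessThan sum_distrib_left ac_simps intro!: sum.cong)
    also have "\<dots> = 0" using Pu by simp
    finally show ?thesis .
  qed
  hence "conjugate u = 0\<^sub>v D" using ann[of "conjugate u"] uc by simp
  hence "conjugate (conjugate u) = conjugate (0\<^sub>v D)" by simp
  hence u0: "u = 0\<^sub>v D" by auto
  have "x = u + P *\<^sub>v x" unfolding u_def using x P(1) by (intro eq_vecI) auto
  hence "x = P *\<^sub>v x" using u0 x P(1) by auto
  thus False using x P(4) by blast
qed

section \<open>Noncommutative polynomials and Burnside's theorem\<close>

definition rep :: "nat \<Rightarrow> ('g \<Rightarrow> complex mat) \<Rightarrow> bool" where
  "rep D M \<longleftrightarrow> (\<forall>g. M g \<in> carrier_mat D D)"

lemma repD [simp]: "rep D M \<Longrightarrow> M g \<in> carrier_mat D D"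
  unfolding rep_def by auto

definition word_mat :: "nat \<Rightarrow> ('g \<Rightarrow> complex mat) \<Rightarrow> 'g list \<Rightarrow> complex mat" where
  "word_mat D M w = foldr (\<lambda>g X. M g * X) w (1\<^sub>m D)"

lemma word_mat_simps [simp]:
  "word_mat D M [] = 1\<^sub>m D" "word_mat D M (g # w) = M g * word_mat D M w"
  unfolding word_mat_def by auto

lemma word_mat_carrier [simp]: "rep D M \<Longrightarrow> word_mat D M w \<in> carrier_mat D D"
  by (induction w) (auto intro: mult_carrier_mat[of _ D D])

lemma word_mat_append:
  "rep D M \<Longrightarrow> word_mat D M (v @ w) = word_mat D M v * word_mat D M w"
  by (induction v) (simp_all add: assoc_mult_mat[of _ D D _ D _ D] left_mult_one_mat[of _ D D])

text \<open>Noncommutative polynomials are lists of coefficients and words, so that one polynomial can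
  be evaluated at matrices of different dimensions.\<close>

type_synonym 'g ncpoly = "(complex \<times> 'g list) list"

primrec poly_mat :: "nat \<Rightarrow> ('g \<Rightarrow> complex mat) \<Rightarrow> 'g ncpoly \<Rightarrow> complex mat" where
  "poly_mat D M [] = 0\<^sub>m D D"
| "poly_mat D M (m # p) = fst m \<cdot>\<^sub>m word_mat D M (snd m) + poly_mat D M p"

text \<open>The empty word is excluded because its trace is the dimension, which no chain
  coefficient with \<open>N \<ge> 1\<close> supplies directly.\<close>

definition nonconst :: "'g ncpoly \<Rightarrow> bool" where
  "nonconst p \<longleftrightarrow> (\<forall>m\<in>set p. snd m \<noteq> [])"

definition poly_scale :: "complex \<Rightarrow> 'g ncpoly \<Rightarrow> 'g ncpoly" where
  "poly_scale a p = map (\<lambda>m. (a * fst m, snd m)) p"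

definition poly_mult :: "'g ncpoly \<Rightarrow> 'g ncpoly \<Rightarrow> 'g ncpoly" where
  "poly_mult p q = concat (map (\<lambda>m. map (\<lambda>l. (fst m * fst l, snd m @ snd l)) q) p)"

lemma poly_mat_carrier [simp]: "rep D M \<Longrightarrow> poly_mat D M p \<in> carrier_mat D D"
  by (induction p) (simp_all add: add_carrier_mat)

lemma poly_mat_append:
  "rep D M \<Longrightarrow> poly_mat D M (p @ q) = poly_mat D M p + poly_mat D M q"
  by (induction p) (simp_all add: assoc_add_mat[of _ D D] left_add_zero_mat[of _ D D])

lemma poly_mat_scale:
  "rep D M \<Longrightarrow> poly_mat D M (poly_scale a p) = a \<cdot>\<^sub>m poly_mat D M p"
proof (induction p)
  case (Cons m p)
  have "a \<cdot>\<^sub>m (fst m \<cdot>\<^sub>m word_mat D M (snd m)) = (a * fst m) \<cdot>\<^sub>m word_mat D M (snd m)"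
    by (intro eq_matI) auto
  thus ?case using Cons by (simp add: poly_scale_def add_smult_distrib_left_mat[of _ D D])
qed (auto simp: poly_scale_def)

lemma poly_mat_mult:
  assumes r: "rep D M"
  shows "poly_mat D M (poly_mult p q) = poly_mat D M p * poly_mat D M q"
proof -
  have mono: "poly_mat D M (map (\<lambda>l. (c * fst l, v @ snd l)) q) =
    (c \<cdot>\<^sub>m word_mat D M v) * poly_mat D M q" for c v
  proof (induction q)
    case Nil
    thus ?case using r by (simp add: right_mult_zero_mat[of _ D D])
  next
    case (Cons l q)
    have "(c * fst l) \<cdot>\<^sub>m (word_mat D M v * word_mat D M (snd l)) =
      (c \<cdot>\<^sub>m word_mat D M v) * (fst l \<cdot>\<^sub>m word_mat D M (snd l))"
      using r by (simp add: mult_smult_distrib[of _ D D _ D] mult_smult_assoc_mat[of _ D D _ D] smult_smult_mat ac_simps)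
    thus ?case using Cons r
      by (simp add: word_mat_append mult_add_distrib_mat[of _ D D _ D])
  qed
  show ?thesis
    using r by (induction p)
      (simp_all add: poly_mult_def poly_mat_append mono add_mult_distrib_mat[of _ D D _ _ D]
        left_mult_zero_mat[of _ D D])
qed

lemma nonconst_simps [simp]:
  "nonconst []" "nonconst (m # p) \<longleftrightarrow> snd m \<noteq> [] \<and> nonconst p"
  "nonconst (p @ q) \<longleftrightarrow> nonconst p \<and> nonconst q"
  "nonconst (poly_scale a p) \<longleftrightarrow> nonconst p"
  "nonconst p \<Longrightarrow> nonconst (poly_mult p q)"
  unfolding nonconst_def poly_scale_def poly_mult_def by auto

section \<open>The generated algebra without identity, and irreducible families\<close>

definition alg :: "nat \<Rightarrow> ('g \<Rightarrow> complex mat) \<Rightarrow> complex mat set" where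
  "alg D M = poly_mat D M ` {p. nonconst p}"

lemma alg_carrier: "rep D M \<Longrightarrow> X \<in> alg D M \<Longrightarrow> X \<in> carrier_mat D D"
  unfolding alg_def by auto

lemma alg_zero: "0\<^sub>m D D \<in> alg D M"
  unfolding alg_def by (rule image_eqI[of _ _ "[]"]) auto

lemma alg_gen: "rep D M \<Longrightarrow> M g \<in> alg D M"
  unfolding alg_def
  by (rule image_eqI[of _ _ "[(1, [g])]"]) (auto simp: right_mult_one_mat[of _ D D])

lemma alg_add:
  assumes "rep D M" "X \<in> alg D M" "Y \<in> alg D M" shows "X + Y \<in> alg D M"
proof -
  obtain p q where "nonconst p" "X = poly_mat D M p" "nonconst q" "Y = poly_mat D M q"
    using assms(2,3) unfolding alg_def by auto
  thus ?thesis unfolding alg_def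
    by (intro image_eqI[of _ _ "p @ q"]) (auto simp: poly_mat_append assms(1))
qed

lemma alg_smult:
  assumes "rep D M" "X \<in> alg D M" shows "c \<cdot>\<^sub>m X \<in> alg D M"
proof -
  obtain p where "nonconst p" "X = poly_mat D M p" using assms(2) unfolding alg_def by auto
  thus ?thesis unfolding alg_def
    by (intro image_eqI[of _ _ "poly_scale c p"]) (auto simp: poly_mat_scale assms(1))
qed

lemma alg_mult:
  assumes "rep D M" "X \<in> alg D M" "Y \<in> alg D M" shows "X * Y \<in> alg D M"
proof -
  obtain p q where "nonconst p" "X = poly_mat D M p" "nonconst q" "Y = poly_mat D M q"
    using assms(2,3) unfolding alg_def by auto
  thus ?thesis unfolding alg_def
    by (intro image_eqI[of _ _ "poly_mult p q"]) (auto simp: poly_mat_mult assms(1))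
qed

text \<open>The second condition excludes the one-dimensional zero representation; the algebra
  generated by the matrices is not assumed to contain the identity.\<close>

definition irred :: "nat \<Rightarrow> ('g \<Rightarrow> complex mat) \<Rightarrow> bool" where
  "irred D M \<longleftrightarrow> rep D M \<and> (\<exists>g. M g \<noteq> 0\<^sub>m D D) \<and>
     (\<forall>W. lin_subspace D W \<and> (\<forall>g. \<forall>w\<in>W. M g *\<^sub>v w \<in> W) \<longrightarrow> W = {0\<^sub>v D} \<or> W = carrier_vec D)"

lemma irredD:
  assumes "irred D M"
  shows "rep D M" and "\<exists>g. M g \<noteq> 0\<^sub>m D D"
    and "lin_subspace D W \<Longrightarrow> (\<And>g w. w \<in> W \<Longrightarrow> M g *\<^sub>v w \<in> W) \<Longrightarrow> W = {0\<^sub>v D} \<or> W = carrier_vec D"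
  using assms unfolding irred_def by auto

lemma irred_dim_pos: "irred D M \<Longrightarrow> 0 < D"
proof (rule ccontr)
  assume i: "irred D M" and "\<not> 0 < D"
  hence "D = 0" by simp
  then obtain g where "M g \<noteq> 0\<^sub>m 0 0" "M g \<in> carrier_mat 0 0" using irredD[OF i] by fastforce
  thus False by (auto intro: eq_matI)
qed

text \<open>The common kernel is itself invariant; were it the whole space, all matrices would
  vanish. This stands in for the identity matrix, not yet known to lie in the algebra.\<close>

lemma irred_common_kernel:
  assumes i: "irred D M" and v: "v \<in> carrier_vec D" "\<And>g. M g *\<^sub>v v = 0\<^sub>v D"
  shows "v = 0\<^sub>v D"
proof (rule ccontr)
  assume v0: "v \<noteq> 0\<^sub>v D"
  note r = irredD(1)[OF i]
  define U where "U = {x \<in> carrier_vec D. \<forall>g. M g *\<^sub>v x = 0\<^sub>v D}"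
  have "lin_subspace D U" unfolding lin_subspace_def U_def using r
    by (auto simp: mult_add_distrib_mat_vec[of _ D D] mult_mat_vec[of _ D D] mat_mult_zero_vec[of _ D D])
  moreover have "M g *\<^sub>v w \<in> U" if "w \<in> U" for g w
    using that r unfolding U_def by auto
  ultimately have "U = {0\<^sub>v D} \<or> U = carrier_vec D" by (rule irredD(3)[OF i])
  moreover have "v \<in> U" unfolding U_def using v by auto
  ultimately have U: "U = carrier_vec D" using v0 by auto
  have "M g = 0\<^sub>m D D" for g
    using r U by (intro mat_eq_by_vec[of _ D D]) (auto simp: U_def)
  thus False using irredD(2)[OF i] by blast
qed

text \<open>The orbit of \<open>v\<close> under the algebra is invariant. Without an identity it
  does not visibly contain \<open>v\<close>, so that it is nonzero rests on the triviality of the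
  common kernel.\<close>

lemma irred_cyclic:
  assumes i: "irred D M" and v: "v \<in> carrier_vec D" "v \<noteq> 0\<^sub>v D" and y: "y \<in> carrier_vec D"
  shows "\<exists>X\<in>alg D M. X *\<^sub>v v = y"
proof -
  note r = irredD(1)[OF i]
  define W where "W = (\<lambda>X. X *\<^sub>v v) ` alg D M"
  have "lin_subspace D W" unfolding lin_subspace_def
  proof (intro conjI ballI allI)
    show "W \<subseteq> carrier_vec D" unfolding W_def using alg_carrier[OF r] v
      by (auto intro: mult_mat_vec_carrier[of _ D D])
    show "0\<^sub>v D \<in> W" unfolding W_def using v by (intro image_eqI[OF _ alg_zero]) auto
    fix x assume "x \<in> W"
    then obtain X where X: "x = X *\<^sub>v v" "X \<in> alg D M" unfolding W_def by auto
    show "c \<cdot>\<^sub>v x \<in> W" for c unfolding W_def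
      using X v alg_carrier[OF r X(2)]
      by (intro image_eqI[OF _ alg_smult[OF r X(2), of c]]) (simp add: smult_mat_mult_vec[of _ D D])
    fix y assume "y \<in> W"
    then obtain Y where Y: "y = Y *\<^sub>v v" "Y \<in> alg D M" unfolding W_def by auto
    show "x + y \<in> W" unfolding W_def
      using X Y v alg_carrier[OF r X(2)] alg_carrier[OF r Y(2)]
      by (intro image_eqI[OF _ alg_add[OF r X(2) Y(2)]]) (simp add: add_mult_distrib_mat_vec[of _ D D])
  qed
  moreover have "M g *\<^sub>v w \<in> W" if w: "w \<in> W" for g w
  proof -
    obtain X where X: "w = X *\<^sub>v v" "X \<in> alg D M" using w unfolding W_def by auto
    show ?thesis unfolding W_def
      using X v r alg_carrier[OF r X(2)]
      by (intro image_eqI[OF _ alg_mult[OF r alg_gen[OF r, of g] X(2)]]) (simp add: assoc_mult_mat_vec[of _ D D])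
  qed
  ultimately have "W = {0\<^sub>v D} \<or> W = carrier_vec D" by (rule irredD(3)[OF i])
  moreover have "W \<noteq> {0\<^sub>v D}"
  proof
    assume "W = {0\<^sub>v D}"
    hence "M g *\<^sub>v v = 0\<^sub>v D" for g using alg_gen[OF r, of g] unfolding W_def by blast
    thus False using irred_common_kernel[OF i v(1)] v(2) by auto
  qed
  ultimately show ?thesis using y unfolding W_def by (metis imageE)
qed

text \<open>Low rank is expressed as factoring through a smaller space: a nonzero entry of
  \<open>w\<close> makes the corresponding column of \<open>N\<close> a combination of the others,
  so \<open>L\<close> only needs the remaining columns.\<close>

lemma singular_factor:
  fixes N :: "complex mat"
  assumes N: "N \<in> carrier_mat (Suc m) (Suc m)" and w: "w \<in> carrier_vec (Suc m)"
    "w \<noteq> 0\<^sub>v (Suc m)" "N *\<^sub>v w = 0\<^sub>v (Suc m)"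
  shows "\<exists>L R. L \<in> carrier_mat (Suc m) m \<and> R \<in> carrier_mat m (Suc m) \<and> N = L * R"
proof -
  obtain i where i: "i < Suc m" "w $ i \<noteq> 0"
  proof -
    have "\<exists>i<Suc m. w $ i \<noteq> 0"
    proof (rule ccontr)
      assume "\<not> ?thesis"
      hence "w = 0\<^sub>v (Suc m)" using w by (intro eq_vecI) auto
      thus False using w by simp
    qed
    thus ?thesis using that by blast
  qed
  \<comment> \<open>The increasing enumeration of the indices other than \<open>i\<close>.\<close>
  define s where "s a = (if a < i then a else Suc a)" for a
  have "x = i" if "\<not> (if x < i then x else x - 1) < m" "x < Suc m" for x
    using that i by (auto split: if_splits)
  note x_eq = this
  have bij: "bij_betw s {..<m} ({..<Suc m} - {i})"
    by (rule bij_betwI[of _ _ _ "\<lambda>b. if b < i then b else b - 1"])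
      (use i in \<open>auto simp: s_def intro: x_eq\<close>)
  have reidx: "(\<Sum>a<m. h (s a)) = (\<Sum>b\<in>{..<Suc m} - {i}. h b)" for h :: "nat \<Rightarrow> complex"
    by (rule sum.reindex_bij_betw[OF bij])
  have sm: "s a < Suc m" if "a < m" for a using that unfolding s_def by auto
  define L where "L = mat (Suc m) m (\<lambda>(r, a). N $$ (r, s a))"
  \<comment> \<open>A column \<open>b \<noteq> i\<close> is the unit vector selecting its copy in
    \<open>L\<close>; column \<open>i\<close> holds the coefficients \<open>- w_j / w_i\<close>
    obtained by solving \<open>N w = 0\<close> for column \<open>i\<close> of
    \<open>N\<close>.\<close>
  define R where "R = mat m (Suc m) (\<lambda>(a, b).
    (if b = s a then 1 else 0) - (if b = i then w $ s a / w $ i else 0))"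
  have "N = L * R"
  proof (rule eq_matI)
    fix r b assume "r < dim_row (L * R)" "b < dim_col (L * R)"
    hence rb: "r < Suc m" "b < Suc m" by (auto simp: L_def R_def)
    have row: "(\<Sum>j\<in>{..<Suc m} - {i}. N $$ (r, j) * w $ j) = - N $$ (r, i) * w $ i"
    proof -
      have "0 = (N *\<^sub>v w) $ r" using w rb by simp
      also have "\<dots> = (\<Sum>j<Suc m. N $$ (r, j) * w $ j)"
        using N w(1) rb by (simp add: scalar_prod_def atLeast0LessThan del: sum.lessThan_Suc)
      also have "\<dots> = N $$ (r, i) * w $ i + (\<Sum>j\<in>{..<Suc m} - {i}. N $$ (r, j) * w $ j)"
        using i by (intro sum.remove) auto
      finally show ?thesis by (simp add: add_eq_0_iff)
    qed
    have "(L * R) $$ (r, b) = (\<Sum>a<m. N $$ (r, s a) *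
        ((if b = s a then 1 else 0) - (if b = i then w $ s a / w $ i else 0)))"
      using rb by (auto simp: L_def R_def scalar_prod_def atLeast0LessThan intro!: sum.cong)
    also have "\<dots> = (\<Sum>j\<in>{..<Suc m} - {i}. N $$ (r, j) *
        ((if b = j then 1 else 0) - (if b = i then w $ j / w $ i else 0)))"
      by (rule reidx)
    also have "\<dots> = N $$ (r, b)"
    proof (cases "b = i")
      case True
      have "(\<Sum>j\<in>{..<Suc m} - {i}. N $$ (r, j) *
        ((if b = j then 1 else 0) - (if b = i then w $ j / w $ i else 0)))
        = (\<Sum>j\<in>{..<Suc m} - {i}. - (N $$ (r, j) * w $ j) / w $ i)"
        using True by (intro sum.cong) auto
      also have "\<dots> = - (\<Sum>j\<in>{..<Suc m} - {i}. N $$ (r, j) * w $ j) / w $ i"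
        unfolding sum_negf[symmetric] sum_divide_distrib by (rule refl)
      finally show ?thesis unfolding row using i True by simp
    next
      case False
      have "(\<Sum>j\<in>{..<Suc m} - {i}. N $$ (r, j) *
        ((if b = j then 1 else 0) - (if b = i then w $ j / w $ i else 0)))
        = (\<Sum>j\<in>{..<Suc m} - {i}. if b = j then N $$ (r, j) else 0)"
        using False by (intro sum.cong) auto
      thus ?thesis using False rb by (simp add: sum.delta' del: sum.lessThan_Suc)
    qed
    finally show "N $$ (r, b) = (L * R) $$ (r, b)" by simp
  qed (use N in \<open>auto simp: L_def R_def\<close>)
  thus ?thesis by (intro exI[of _ L] exI[of _ R]) (auto simp: L_def R_def)
qed

text \<open>An element \<open>T = P Q\<close> of minimal rank satisfies \<open>T A T = \<lambda> T\<close>: take \<open>\<lambda>\<close> an eigenvalue of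
  \<open>Q A P\<close>; then \<open>T A T - \<lambda> T = P (Q A P - \<lambda>) Q\<close> has smaller rank.\<close>

lemma irred_minimal_element:
  assumes i: "irred D M"
  shows "\<exists>T\<in>alg D M. T \<noteq> 0\<^sub>m D D \<and> (\<forall>A\<in>alg D M. \<exists>c. T * A * T = c \<cdot>\<^sub>m T)"
proof -
  note r = irredD(1)[OF i]
  \<comment> \<open>Some nonzero element of the algebra has rank at most \<open>m\<close>.\<close>
  define F where "F m \<longleftrightarrow> (\<exists>P Q. P \<in> carrier_mat D m \<and> Q \<in> carrier_mat m D \<and>
    P * Q \<in> alg D M \<and> P * Q \<noteq> 0\<^sub>m D D)" for m
  obtain g where g: "M g \<noteq> 0\<^sub>m D D" using irredD(2)[OF i] by auto
  have "F D" unfolding F_def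
    using r g alg_gen[OF r, of g] by (intro exI[of _ "M g"] exI[of _ "1\<^sub>m D"]) (auto simp: right_mult_one_mat[of _ D D])
  define m where "m = (LEAST m. F m)"
  have Fm: "F m" unfolding m_def using \<open>F D\<close> by (rule LeastI)
  have min: "\<not> F k" if "k < m" for k using that unfolding m_def by (rule not_less_Least)
  obtain P Q where P: "P \<in> carrier_mat D m" and Q: "Q \<in> carrier_mat m D"
    and PQ: "P * Q \<in> alg D M" "P * Q \<noteq> 0\<^sub>m D D" using Fm unfolding F_def by auto
  have "m \<noteq> 0"
  proof
    assume "m = 0"
    hence "P * Q = 0\<^sub>m D D" using P Q by (intro eq_matI) (auto simp: scalar_prod_def)
    thus False using PQ by simp
  qed
  then obtain k where k: "m = Suc k" by (cases m) auto
  define T where "T = P * Q"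
  have Tc: "T \<in> carrier_mat D D" unfolding T_def using P Q by simp
  have TA: "T \<in> alg D M" unfolding T_def using PQ by simp
  have "\<exists>c. T * A * T = c \<cdot>\<^sub>m T" if A: "A \<in> alg D M" for A
  proof -
    have Ac: "A \<in> carrier_mat D D" using alg_carrier[OF r A] .
    \<comment> \<open>A square matrix of positive size, so it has an eigenvalue, although
      \<open>P\<close> and \<open>Q\<close> may be rectangular.\<close>
    have QAP: "Q * A * P \<in> carrier_mat m m" using P Q Ac by simp
    obtain c where "eigenvalue (Q * A * P) c"
      using spectrum_non_empty[OF QAP] k unfolding spectrum_def by auto
    then obtain w where w: "w \<in> carrier_vec m" "w \<noteq> 0\<^sub>v m" "(Q * A * P) *\<^sub>v w = c \<cdot>\<^sub>v w"
      unfolding eigenvalue_def eigenvector_def using Q by auto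
    define N where "N = Q * A * P + (- c) \<cdot>\<^sub>m 1\<^sub>m m"
    have Nc: "N \<in> carrier_mat m m" unfolding N_def using QAP by simp
    have "N *\<^sub>v w = 0\<^sub>v m"
      unfolding N_def using QAP w
      by (subst add_mult_distrib_mat_vec[of _ m m]) (auto simp: smult_mat_mult_vec[of _ m m] simp del: assoc_mult_mat_vec)
    \<comment> \<open>The shifted matrix is singular and so factors through size \<open>k\<close>.
      This makes \<open>S\<close> an algebra element of rank at most \<open>k\<close>, hence zero by
      minimality.\<close>
    then obtain L R where LR: "L \<in> carrier_mat m k" "R \<in> carrier_mat k m" "N = L * R"
      using singular_factor[of N k w] Nc w(1,2) unfolding k by auto
    define S where "S = T * A * T + (- c) \<cdot>\<^sub>m T"
    have SA: "S \<in> alg D M" unfolding S_def using A TA r by (intro alg_add alg_smult alg_mult)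
    have "S = P * N * Q"
    proof -
      have "P * N * Q = P * (N * Q)" using P Q Nc by (simp add: assoc_mult_mat[of _ D m _ m _ D])
      also have "N * Q = Q * A * P * Q + (- c) \<cdot>\<^sub>m Q"
        unfolding N_def using QAP Q
        by (simp add: add_mult_distrib_mat[of _ m m _ _ D] mult_smult_assoc_mat[of _ m m _ D] left_mult_one_mat[of _ m D])
      also have "P * (Q * A * P * Q + (- c) \<cdot>\<^sub>m Q) = P * (Q * A * P * Q) + (- c) \<cdot>\<^sub>m (P * Q)"
        using QAP P Q by (simp add: mult_add_distrib_mat[of _ D m _ D] mult_smult_distrib[of _ D m _ D])
      also have "P * (Q * A * P * Q) = T * A * T"
      proof -
        have "Q * A * P * Q = Q * A * (P * Q)" using P Q Ac by (intro assoc_mult_mat[of _ m D _ m _ D]) auto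
        moreover have "P * (Q * A * (P * Q)) = P * (Q * A) * (P * Q)"
          using P Q Ac by (intro assoc_mult_mat[symmetric, of _ D m _ D _ D]) auto
        moreover have "P * (Q * A) = P * Q * A" using P Q Ac by (intro assoc_mult_mat[symmetric, of _ D m _ D _ D]) auto
        ultimately show ?thesis unfolding T_def by simp
      qed
      finally show ?thesis unfolding S_def T_def by simp
    qed
    also have "\<dots> = (P * L) * (R * Q)"
    proof -
      have "P * (L * R) = P * L * R" using P LR by (intro assoc_mult_mat[symmetric, of _ D m _ k _ m]) auto
      moreover have "P * L * R * Q = P * L * (R * Q)" using P Q LR by (intro assoc_mult_mat[of _ D k _ m _ D]) auto
      ultimately show ?thesis unfolding LR(3) by simp
    qed
    finally have S: "S = (P * L) * (R * Q)" .
    have "S = 0\<^sub>m D D"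
    proof (rule ccontr)
      assume "S \<noteq> 0\<^sub>m D D"
      hence "F k" unfolding F_def using S SA P Q LR
        by (intro exI[of _ "P * L"] exI[of _ "R * Q"]) auto
      thus False using min[of k] k by simp
    qed
    have "T * A * T = c \<cdot>\<^sub>m T"
    proof (rule eq_matI)
      fix a b assume "a < dim_row (c \<cdot>\<^sub>m T)" "b < dim_col (c \<cdot>\<^sub>m T)"
      hence ab: "a < D" "b < D" using Tc by auto
      have "S $$ (a, b) = 0" using \<open>S = 0\<^sub>m D D\<close> ab by simp
      thus "(T * A * T) $$ (a, b) = (c \<cdot>\<^sub>m T) $$ (a, b)"
        unfolding S_def using ab Tc Ac by simp
    qed (use Tc Ac in auto)
    thus ?thesis by blast
  qed
  thus ?thesis using TA PQ(2) unfolding T_def by blast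
qed

text \<open>The relation \<open>T * A * T = c T\<close> forces rank one: by cyclicity every
  \<open>y\<close> equals \<open>A (T x)\<close> for a fixed \<open>x\<close> and some
  \<open>A\<close> in the algebra, so \<open>T y\<close> is a multiple of
  \<open>T x\<close>.\<close>

lemma irred_rank_one:
  assumes i: "irred D M"
  shows "\<exists>u f. u \<in> carrier_vec D \<and> u \<noteq> 0\<^sub>v D \<and> f \<in> carrier_vec D \<and> f \<noteq> 0\<^sub>v D \<and> outer u f \<in> alg D M"
proof -
  note r = irredD(1)[OF i]
  obtain T where T: "T \<in> alg D M" "T \<noteq> 0\<^sub>m D D" "\<And>A. A \<in> alg D M \<Longrightarrow> \<exists>c. T * A * T = c \<cdot>\<^sub>m T"
    using irred_minimal_element[OF i] by blast
  have Tc: "T \<in> carrier_mat D D" using alg_carrier[OF r T(1)] .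
  obtain x where x: "x \<in> carrier_vec D" "T *\<^sub>v x \<noteq> 0\<^sub>v D"
  proof -
    have "\<exists>x\<in>carrier_vec D. T *\<^sub>v x \<noteq> 0\<^sub>v D"
    proof (rule ccontr)
      assume "\<not> ?thesis"
      hence "T = 0\<^sub>m D D" using Tc by (intro mat_eq_by_vec[of _ D D]) auto
      thus False using T(2) by simp
    qed
    thus ?thesis using that by blast
  qed
  define u where "u = T *\<^sub>v x"
  have u: "u \<in> carrier_vec D" "u \<noteq> 0\<^sub>v D" unfolding u_def using Tc x by auto
  have "\<exists>c. T *\<^sub>v y = c \<cdot>\<^sub>v u" if y: "y \<in> carrier_vec D" for y
  proof -
    obtain A where A: "A \<in> alg D M" "A *\<^sub>v u = y" using irred_cyclic[OF i u y] by auto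
    have Ac: "A \<in> carrier_mat D D" using alg_carrier[OF r A(1)] .
    obtain c where c: "T * A * T = c \<cdot>\<^sub>m T" using T(3)[OF A(1)] by auto
    have "T *\<^sub>v y = (T * A * T) *\<^sub>v x"
      unfolding A(2)[symmetric] u_def using Tc Ac x
      by (simp add: assoc_mult_mat_vec[of _ D D _ D] assoc_mult_mat[of _ D D _ D _ D])
    also have "\<dots> = c \<cdot>\<^sub>v u" unfolding c u_def using Tc x by (simp add: smult_mat_mult_vec[of _ D D])
    finally show ?thesis by blast
  qed
  hence "\<forall>j. \<exists>c. T *\<^sub>v unit_vec D j = c \<cdot>\<^sub>v u" by simp
  then obtain c where c: "\<And>j. T *\<^sub>v unit_vec D j = c j \<cdot>\<^sub>v u" by metis
  define f where "f = vec D c"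
  have T_eq: "T = outer u f"
  proof (rule eq_matI)
    fix a b assume "a < dim_row (outer u f)" "b < dim_col (outer u f)"
    hence ab: "a < D" "b < D" using u by (auto simp: outer_def f_def)
    have "(T *\<^sub>v unit_vec D b) $ a = (c b \<cdot>\<^sub>v u) $ a" using c by simp
    thus "T $$ (a, b) = outer u f $$ (a, b)" using ab Tc u by (simp add: outer_def f_def)
  qed (use Tc u in \<open>auto simp: outer_def f_def\<close>)
  have "f \<noteq> 0\<^sub>v D"
  proof
    assume "f = 0\<^sub>v D"
    hence "T = 0\<^sub>m D D" unfolding T_eq using u by (simp add: outer_zero)
    thus False using T(2) by simp
  qed
  thus ?thesis using u T(1) T_eq by (intro exI[of _ u] exI[of _ f]) (auto simp: f_def)
qed

text \<open>A matrix is the sum of its columns times unit row vectors; the induction adjoins one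
  column at a time.\<close>

lemma outer_span:
  assumes zero: "0\<^sub>m m n \<in> S" and add: "\<And>X Y. X \<in> S \<Longrightarrow> Y \<in> S \<Longrightarrow> X + Y \<in> S"
    and outer: "\<And>y h. y \<in> carrier_vec m \<Longrightarrow> h \<in> carrier_vec n \<Longrightarrow> outer y h \<in> S"
    and X: "X \<in> carrier_mat m n"
  shows "X \<in> S"
proof -
  have "mat m n (\<lambda>(i, j). if j < k then X $$ (i, j) else 0) \<in> S" if "k \<le> n" for k
    using that
  proof (induction k)
    case 0
    have "mat m n (\<lambda>(i, j). if j < 0 then X $$ (i, j) else 0) = 0\<^sub>m m n" by (intro eq_matI) auto
    thus ?case using zero by metis
  next
    case (Suc k)
    have "mat m n (\<lambda>(i, j). if j < Suc k then X $$ (i, j) else 0) =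
      mat m n (\<lambda>(i, j). if j < k then X $$ (i, j) else 0) + outer (col X k) (unit_vec n k)"
      using X Suc.prems by (intro eq_matI) (auto simp: outer_def less_Suc_eq unit_vec_def)
    thus ?case using Suc X by (auto intro!: add outer)
  qed
  from this[of n] have "mat m n (\<lambda>(i, j). if j < n then X $$ (i, j) else 0) \<in> S" by simp
  also have "mat m n (\<lambda>(i, j). if j < n then X $$ (i, j) else 0) = X" using X by (intro eq_matI) auto
  finally show ?thesis .
qed

text \<open>Burnside's theorem. From a single rank-one element, right factors move the functional
  and left factors the vector to arbitrary position, and the rank-one matrices span.\<close>

theorem irred_alg_eq_carrier:
  assumes i: "irred D M"
  shows "alg D M = carrier_mat D D"
proof
  note r = irredD(1)[OF i]
  show "alg D M \<subseteq> carrier_mat D D" using alg_carrier[OF r] by auto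
  obtain u f where u: "u \<in> carrier_vec D" "u \<noteq> 0\<^sub>v D" and f: "f \<in> carrier_vec D" "f \<noteq> 0\<^sub>v D"
    and uf: "outer u f \<in> alg D M" using irred_rank_one[OF i] by auto
  define G where "G = {h \<in> carrier_vec D. outer u h \<in> alg D M}"
  have "G = carrier_vec D"
  proof (rule subspace_eq_carrier)
    have add: "outer u (h + k) = outer u h + outer u k" if "h \<in> carrier_vec D" "k \<in> carrier_vec D" for h k
      using that by (intro eq_matI) (auto simp: outer_def distrib_left)
    have smult: "outer u (c \<cdot>\<^sub>v h) = c \<cdot>\<^sub>m outer u h" for h c
      by (intro eq_matI) (auto simp: outer_def)
    show "lin_subspace D G" unfolding lin_subspace_def G_def
      using alg_add[OF r] alg_smult[OF r] alg_zero[of D M] u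
      by (auto simp: add smult outer_zero)
    fix v assume v: "v \<in> carrier_vec D" and ann: "\<And>h. h \<in> G \<Longrightarrow> h \<bullet> v = 0"
    show "v = 0\<^sub>v D"
    proof (rule ccontr)
      assume v0: "v \<noteq> 0\<^sub>v D"
      \<comment> \<open>If \<open>v\<close> is annihilated by every \<open>B^T f\<close>, then
        \<open>f\<close> vanishes on every \<open>B v\<close>; the orbit of \<open>v\<close> is the
        whole space, so \<open>f\<close> would be zero.\<close>
      have "f \<bullet> y = 0" if y: "y \<in> carrier_vec D" for y
      proof -
        obtain B where B: "B \<in> alg D M" "B *\<^sub>v v = y" using irred_cyclic[OF i v v0 y] by auto
        have Bc: "B \<in> carrier_mat D D" using alg_carrier[OF r B(1)] .
        have "B\<^sup>T *\<^sub>v f \<in> G"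
          unfolding G_def using alg_mult[OF r uf B(1)] Bc f by (simp add: outer_mult[of _ D D])
        hence "(B\<^sup>T *\<^sub>v f) \<bullet> v = 0" by (rule ann)
        moreover have "(B\<^sup>T *\<^sub>v f) \<bullet> v = f \<bullet> (B *\<^sub>v v)"
          using Bc f v transpose_vec_mult_scalar[OF Bc v f(1)] by simp
        ultimately show ?thesis using B(2) by simp
      qed
      hence "f \<bullet> unit_vec D j = 0" for j by simp
      hence "f = 0\<^sub>v D" using f by (intro eq_vecI) (metis index_zero_vec(1) index_zero_vec(2) scalar_prod_right_unit, simp)
      thus False using f by simp
    qed
  qed
  hence uh: "outer u h \<in> alg D M" if "h \<in> carrier_vec D" for h using that unfolding G_def by auto
  have yh: "outer y h \<in> alg D M" if y: "y \<in> carrier_vec D" and h: "h \<in> carrier_vec D" for y h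
  proof -
    obtain A where A: "A \<in> alg D M" "A *\<^sub>v u = y" using irred_cyclic[OF i u y] by auto
    have "A * outer u h \<in> alg D M" using alg_mult[OF r A(1) uh[OF h]] .
    thus ?thesis using mult_outer[OF alg_carrier[OF r A(1)] u(1)] A(2) by simp
  qed
  show "carrier_mat D D \<subseteq> alg D M"
    using outer_span[OF alg_zero alg_add[OF r] yh] by blast
qed

section \<open>Separating and matching irreducible families\<close>

text \<open>The columns are the images of the unit vectors; agreement is extended from vectors
  supported on the first \<open>k\<close> coordinates to one coordinate more.\<close>

lemma linear_map_matrix:
  fixes f :: "complex vec \<Rightarrow> complex vec"
  assumes car: "\<And>y. y \<in> carrier_vec n \<Longrightarrow> f y \<in> carrier_vec m"
    and add: "\<And>y z. y \<in> carrier_vec n \<Longrightarrow> z \<in> carrier_vec n \<Longrightarrow> f (y + z) = f y + f z"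
    and smult: "\<And>c y. y \<in> carrier_vec n \<Longrightarrow> f (c \<cdot>\<^sub>v y) = c \<cdot>\<^sub>v f y"
  shows "\<exists>T\<in>carrier_mat m n. \<forall>y\<in>carrier_vec n. T *\<^sub>v y = f y"
proof -
  define T where "T = mat m n (\<lambda>(i, j). f (unit_vec n j) $ i)"
  have Tc: "T \<in> carrier_mat m n" unfolding T_def by simp
  have Tu: "T *\<^sub>v unit_vec n j = f (unit_vec n j)" if "j < n" for j
    using that car[of "unit_vec n j"] by (intro eq_vecI) (auto simp: T_def)
  have "T *\<^sub>v y = f y" if y: "y \<in> carrier_vec n" for y
  proof -
    have "T *\<^sub>v vec n (\<lambda>j. if j < k then y $ j else 0) = f (vec n (\<lambda>j. if j < k then y $ j else 0))"
      if "k \<le> n" for k using that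
    proof (induction k)
      case 0
      have "vec n (\<lambda>j. if j < 0 then y $ j else 0) = 0 \<cdot>\<^sub>v 0\<^sub>v n" by (intro eq_vecI) auto
      moreover have "f (0 \<cdot>\<^sub>v 0\<^sub>v n) = T *\<^sub>v (0 \<cdot>\<^sub>v 0\<^sub>v n)"
      proof -
        have "f (0 \<cdot>\<^sub>v 0\<^sub>v n) = 0 \<cdot>\<^sub>v f (0\<^sub>v n)" by (rule smult) simp
        also have "\<dots> = 0\<^sub>v m" using car[of "0\<^sub>v n"] by (intro eq_vecI) auto
        finally show ?thesis using Tc by simp
      qed
      ultimately show ?case by metis
    next
      case (Suc k)
      let ?v = "vec n (\<lambda>j. if j < k then y $ j else 0)"
      have eq: "vec n (\<lambda>j. if j < Suc k then y $ j else 0) = ?v + y $ k \<cdot>\<^sub>v unit_vec n k"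
        by (intro eq_vecI) (auto simp: less_Suc_eq unit_vec_def)
      show ?case
        unfolding eq using Suc Tc Tu[of k]
        by (simp add: mult_add_distrib_mat_vec[OF Tc] mult_mat_vec[OF Tc] add smult)
    qed
    from this[of n] have "T *\<^sub>v vec n (\<lambda>j. if j < n then y $ j else 0) = f (vec n (\<lambda>j. if j < n then y $ j else 0))"
      by simp
    also have "vec n (\<lambda>j. if j < n then y $ j else 0) = y" using y by (intro eq_vecI) auto
    finally show ?thesis .
  qed
  thus ?thesis using Tc by blast
qed

section \<open>Equivalence of families, Schur's lemma and separation\<close>

definition equiv_rep :: "nat \<Rightarrow> ('g \<Rightarrow> complex mat) \<Rightarrow> nat \<Rightarrow> ('g \<Rightarrow> complex mat) \<Rightarrow> bool" where
  "equiv_rep D M D' N \<longleftrightarrow> D = D' \<and> (\<exists>T T'. inverse_matrices D T T' \<and> (\<forall>g. M g * T = T * N g))"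

lemma inverse_matricesD:
  assumes "inverse_matrices D T T'"
  shows "T \<in> carrier_mat D D" "T' \<in> carrier_mat D D" "T * T' = 1\<^sub>m D" "T' * T = 1\<^sub>m D"
  using assms unfolding inverse_matrices_def inverts_mat_def by auto

lemma inverse_matricesI:
  "T \<in> carrier_mat D D \<Longrightarrow> T' \<in> carrier_mat D D \<Longrightarrow> T * T' = 1\<^sub>m D \<Longrightarrow> T' * T = 1\<^sub>m D \<Longrightarrow>
    inverse_matrices D T T'"
  unfolding inverse_matrices_def inverts_mat_def by auto

lemma inverse_matrices_one: "inverse_matrices D (1\<^sub>m D) (1\<^sub>m D)"
  by (rule inverse_matricesI) auto

lemma ex_inverse_of_det:
  assumes T: "T \<in> carrier_mat D D" and det: "det T \<noteq> (0 :: complex)"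
  shows "\<exists>T'. inverse_matrices D T T'"
proof -
  from det_non_zero_imp_unit[OF T det, of undefined]
  obtain T' where "T' \<in> carrier_mat D D" "T * T' = 1\<^sub>m D" "T' * T = 1\<^sub>m D"
    unfolding Units_def ring_mat_def by auto
  thus ?thesis using T by (blast intro: inverse_matricesI)
qed

lemma equiv_rep_refl: "rep D M \<Longrightarrow> equiv_rep D M D M"
  unfolding equiv_rep_def using inverse_matrices_one
  by (auto intro!: exI[of _ "1\<^sub>m D"] simp: left_mult_one_mat[of _ D D] right_mult_one_mat[of _ D D])

lemma right_inverse_nonzero_row_col:
  fixes A B :: "complex mat"
  assumes "A \<in> carrier_mat n n" "B \<in> carrier_mat n n" "A * B = 1\<^sub>m n" "i < n"
  shows "\<exists>j<n. A $$ (i, j) \<noteq> 0" "\<exists>j<n. B $$ (j, i) \<noteq> 0"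
proof -
  have "(A * B) $$ (i, i) = 1" using assms by simp
  hence *: "(\<Sum>j<n. A $$ (i, j) * B $$ (j, i)) = 1"
    using assms(1,2,4) by (simp add: scalar_prod_def atLeast0LessThan)
  show "\<exists>j<n. A $$ (i, j) \<noteq> 0"
  proof (rule ccontr)
    assume "\<not> ?thesis"
    hence "(\<Sum>j<n. A $$ (i, j) * B $$ (j, i)) = 0" by (intro sum.neutral) auto
    thus False using * by simp
  qed
  show "\<exists>j<n. B $$ (j, i) \<noteq> 0"
  proof (rule ccontr)
    assume "\<not> ?thesis"
    hence "(\<Sum>j<n. A $$ (i, j) * B $$ (j, i)) = 0" by (intro sum.neutral) auto
    thus False using * by simp
  qed
qed

text \<open>Padding with zeros makes \<open>T\<close> square. If \<open>m < n\<close>, injectivity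
  makes the padded matrix invertible although it has a zero row; if \<open>n < m\<close>,
  surjectivity makes its transpose injective although the padded matrix has a zero column.\<close>

lemma bijective_matrix:
  fixes T :: "complex mat"
  assumes T: "T \<in> carrier_mat m n"
    and inj: "\<And>v. v \<in> carrier_vec n \<Longrightarrow> T *\<^sub>v v = 0\<^sub>v m \<Longrightarrow> v = (0\<^sub>v n :: complex vec)"
    and surj: "\<And>y. y \<in> carrier_vec m \<Longrightarrow> \<exists>v\<in>carrier_vec n. T *\<^sub>v v = y"
  shows "m = n \<and> (\<exists>T'. inverse_matrices m T T')"
proof -
  have "\<not> m < n"
  proof
    assume lt: "m < n"
    define S where "S = mat n n (\<lambda>(i, j). if i < m then T $$ (i, j) else 0)"
    have S: "S \<in> carrier_mat n n" unfolding S_def by simp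
    have "det S \<noteq> 0"
    proof
      assume "det S = 0"
      then obtain v where v: "v \<in> carrier_vec n" "v \<noteq> 0\<^sub>v n" "S *\<^sub>v v = 0\<^sub>v n"
        using det_0_iff_vec_prod_zero[OF S] by auto
      have "T *\<^sub>v v = 0\<^sub>v m"
      proof (rule eq_vecI)
        fix i assume i: "i < dim_vec (0\<^sub>v m)"
        hence "(S *\<^sub>v v) $ i = 0" using v lt by simp
        thus "(T *\<^sub>v v) $ i = 0\<^sub>v m $ i"
          using i lt T v(1) by (simp add: S_def scalar_prod_def)
      qed (use T in auto)
      thus False using inj v by blast
    qed
    then obtain S' where "inverse_matrices n S S'" using ex_inverse_of_det[OF S] by auto
    from right_inverse_nonzero_row_col(1)[OF inverse_matricesD(1,2,3)[OF this] lt]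
    show False using lt by (auto simp: S_def)
  qed
  moreover have "\<not> n < m"
  proof
    assume lt: "n < m"
    define S where "S = mat m m (\<lambda>(i, j). if j < n then T $$ (i, j) else 0)"
    have S: "S \<in> carrier_mat m m" unfolding S_def by simp
    have "det S\<^sup>T \<noteq> 0"
    proof
      assume "det S\<^sup>T = 0"
      then obtain v where v: "v \<in> carrier_vec m" "v \<noteq> 0\<^sub>v m" "S\<^sup>T *\<^sub>v v = 0\<^sub>v m"
        using det_0_iff_vec_prod_zero[of "S\<^sup>T" m] S by auto
      have Tv: "T\<^sup>T *\<^sub>v v = 0\<^sub>v n"
      proof (rule eq_vecI)
        fix i assume i: "i < dim_vec (0\<^sub>v n)"
        hence "(S\<^sup>T *\<^sub>v v) $ i = 0" using v lt by simp
        thus "(T\<^sup>T *\<^sub>v v) $ i = 0\<^sub>v n $ i"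
          using i lt T v(1) by (simp add: S_def scalar_prod_def)
      qed (use T in auto)
      have "v \<bullet> y = 0" if y: "y \<in> carrier_vec m" for y
      proof -
        obtain x where x: "x \<in> carrier_vec n" "T *\<^sub>v x = y" using surj[OF y] by auto
        show ?thesis using transpose_vec_mult_scalar[OF T x(1) v(1)] x Tv by simp
      qed
      hence "v \<bullet> unit_vec m j = 0" for j by simp
      hence "v = 0\<^sub>v m" using v(1)
        by (intro eq_vecI) (metis index_zero_vec(1) index_zero_vec(2) scalar_prod_right_unit, simp)
      thus False using v by simp
    qed
    hence "det S \<noteq> 0" using det_transpose[OF S] by simp
    then obtain S' where "inverse_matrices m S S'" using ex_inverse_of_det[OF S] by auto
    from right_inverse_nonzero_row_col(2)[OF inverse_matricesD(2,1,4)[OF this] lt]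
    show False using lt by (auto simp: S_def)
  qed
  ultimately have mn: "m = n" by simp
  have "det T \<noteq> 0" using det_0_iff_vec_prod_zero[of T m] T inj unfolding mn by auto
  thus ?thesis using ex_inverse_of_det[of T m] T mn by auto
qed

text \<open>Kernel and image of an intertwiner are invariant, so irreducibility on both sides makes
  a nonzero one bijective.\<close>

lemma schur:
  assumes M: "irred D M" and N: "irred D' N" and T: "T \<in> carrier_mat D D'" "T \<noteq> 0\<^sub>m D D'"
    and int: "\<And>g. M g * T = T * N g"
  shows "equiv_rep D M D' N"
proof -
  note r = irredD(1)[OF M] and r' = irredD(1)[OF N]
  have int_vec: "M g *\<^sub>v (T *\<^sub>v v) = T *\<^sub>v (N g *\<^sub>v v)" if "v \<in> carrier_vec D'" for g v
  proof -
    have "M g *\<^sub>v (T *\<^sub>v v) = (M g * T) *\<^sub>v v" using that T r by (simp add: assoc_mult_mat_vec[of _ D D _ D'])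
    also have "\<dots> = T *\<^sub>v (N g *\<^sub>v v)" unfolding int using that T r' by (simp add: assoc_mult_mat_vec[of _ D D' _ D'])
    finally show ?thesis .
  qed
  obtain x where x: "x \<in> carrier_vec D'" "T *\<^sub>v x \<noteq> 0\<^sub>v D"
  proof -
    have "\<exists>x\<in>carrier_vec D'. T *\<^sub>v x \<noteq> 0\<^sub>v D"
    proof (rule ccontr)
      assume "\<not> ?thesis"
      hence "T = 0\<^sub>m D D'" using T by (intro mat_eq_by_vec[of _ D D']) auto
      thus False using T(2) by simp
    qed
    thus ?thesis using that by blast
  qed
  define K where "K = {v \<in> carrier_vec D'. T *\<^sub>v v = 0\<^sub>v D}"
  have "lin_subspace D' K" unfolding lin_subspace_def K_def using T
    by (auto simp: mult_add_distrib_mat_vec[of _ D D'] mult_mat_vec[of _ D D'] mat_mult_zero_vec[of _ D D'])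
  moreover have "N g *\<^sub>v w \<in> K" if "w \<in> K" for g w
    using that r' int_vec[of w g] unfolding K_def by (auto simp: mat_mult_zero_vec[OF repD[OF r]] intro: mult_mat_vec_carrier[of _ D' D'])
  ultimately have "K = {0\<^sub>v D'} \<or> K = carrier_vec D'" by (rule irredD(3)[OF N])
  hence K: "K = {0\<^sub>v D'}" using x unfolding K_def by auto
  define I where "I = (\<lambda>v. T *\<^sub>v v) ` carrier_vec D'"
  have "lin_subspace D I" unfolding lin_subspace_def
  proof (intro conjI ballI allI)
    show "I \<subseteq> carrier_vec D" unfolding I_def using T by auto
    show "0\<^sub>v D \<in> I" unfolding I_def using T by (intro image_eqI[of _ _ "0\<^sub>v D'"]) auto
    fix v assume "v \<in> I"
    then obtain v' where v': "v = T *\<^sub>v v'" "v' \<in> carrier_vec D'" unfolding I_def by auto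
    show "c \<cdot>\<^sub>v v \<in> I" for c unfolding I_def
      using v' T by (intro image_eqI[of _ _ "c \<cdot>\<^sub>v v'"]) (auto simp: mult_mat_vec[of _ D D'])
    fix w assume "w \<in> I"
    then obtain w' where w': "w = T *\<^sub>v w'" "w' \<in> carrier_vec D'" unfolding I_def by auto
    show "v + w \<in> I" unfolding I_def
      using v' w' T by (intro image_eqI[of _ _ "v' + w'"]) (auto simp: mult_add_distrib_mat_vec[of _ D D'])
  qed
  moreover have "M g *\<^sub>v w \<in> I" if w: "w \<in> I" for g w
  proof -
    obtain w' where w': "w = T *\<^sub>v w'" "w' \<in> carrier_vec D'" using w unfolding I_def by auto
    show ?thesis unfolding I_def w' int_vec[OF w'(2)] using r' w'
      by (intro imageI) (auto intro: mult_mat_vec_carrier[of _ D' D'])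
  qed
  ultimately have "I = {0\<^sub>v D} \<or> I = carrier_vec D" by (rule irredD(3)[OF M])
  hence I: "I = carrier_vec D" using x unfolding I_def by auto
  have "D = D' \<and> (\<exists>T'. inverse_matrices D T T')"
  proof (rule bijective_matrix[OF T(1)])
    fix v assume "v \<in> carrier_vec D'" "T *\<^sub>v v = 0\<^sub>v D"
    thus "v = 0\<^sub>v D'" using K unfolding K_def by blast
  next
    fix y :: "complex vec" assume "y \<in> carrier_vec D"
    hence "y \<in> (\<lambda>v. T *\<^sub>v v) ` carrier_vec D'" using I unfolding I_def by simp
    thus "\<exists>v\<in>carrier_vec D'. T *\<^sub>v v = y" by (elim imageE) auto
  qed
  thus ?thesis unfolding equiv_rep_def using int by auto
qed

text \<open>If every polynomial vanishing on \<open>N\<close> vanished on \<open>M\<close>, then \<open>\<phi>: p(N) \<mapsto> p(M)\<close> would be an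
  algebra homomorphism on the full matrix algebra, and \<open>y \<mapsto> \<phi>(y e\<^sub>0\<^sup>T) v\<close> a nonzero intertwiner.\<close>

lemma irred_separation:
  assumes M: "irred D M" and N: "irred D' N" and ne: "\<not> equiv_rep D M D' N"
  shows "\<exists>p. nonconst p \<and> poly_mat D' N p = 0\<^sub>m D' D' \<and> poly_mat D M p \<noteq> 0\<^sub>m D D"
proof (rule ccontr)
  assume no: "\<not> ?thesis"
  note r = irredD(1)[OF M] and r' = irredD(1)[OF N]
  have D': "0 < D'" using irred_dim_pos[OF N] .
  \<comment> \<open>A choice of polynomial with value \<open>X\<close> at \<open>N\<close>,
    available by Burnside's theorem. The contrary assumption makes its value at \<open>M\<close>
    independent of the choice.\<close>
  define pr where "pr X = (SOME p. nonconst p \<and> poly_mat D' N p = X)" for X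
  have pr: "nonconst (pr X) \<and> poly_mat D' N (pr X) = X" if "X \<in> carrier_mat D' D'" for X
  proof -
    have "X \<in> alg D' N" using that irred_alg_eq_carrier[OF N] by simp
    hence "\<exists>p. nonconst p \<and> poly_mat D' N p = X" unfolding alg_def by auto
    thus ?thesis unfolding pr_def by (rule someI_ex)
  qed
  define \<phi> where "\<phi> X = poly_mat D M (pr X)" for X
  have \<phi>c: "\<phi> X \<in> carrier_mat D D" for X unfolding \<phi>_def using r by simp
  have \<phi>: "\<phi> (poly_mat D' N p) = poly_mat D M p" if p: "nonconst p" for p
  proof -
    define q where "q = pr (poly_mat D' N p)"
    have q: "nonconst q" "poly_mat D' N q = poly_mat D' N p"
      using pr[of "poly_mat D' N p"] r' unfolding q_def by auto
    have "poly_mat D' N (q @ poly_scale (-1) p) = 0\<^sub>m D' D'"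
      using q r' carrier_matD[OF poly_mat_carrier[OF r', of p]]
      by (intro eq_matI) (auto simp: poly_mat_append poly_mat_scale)
    hence z: "poly_mat D M (q @ poly_scale (-1) p) = 0\<^sub>m D D" using no q p by auto
    show ?thesis unfolding \<phi>_def q_def[symmetric]
    proof (rule eq_matI)
      fix i j assume "i < dim_row (poly_mat D M p)" "j < dim_col (poly_mat D M p)"
      hence ij: "i < D" "j < D" using carrier_matD[OF poly_mat_carrier[OF r, of p]] by auto
      have "poly_mat D M (q @ poly_scale (-1) p) $$ (i, j) = 0" using z ij by simp
      thus "poly_mat D M q $$ (i, j) = poly_mat D M p $$ (i, j)"
        using ij r carrier_matD[OF poly_mat_carrier[OF r, of p]] carrier_matD[OF poly_mat_carrier[OF r, of q]]
        by (auto simp: poly_mat_append poly_mat_scale)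
    qed (use carrier_matD[OF poly_mat_carrier[OF r, of p]] carrier_matD[OF poly_mat_carrier[OF r, of q]] in auto)
  qed
  have \<phi>_add: "\<phi> (X + Y) = \<phi> X + \<phi> Y" if "X \<in> carrier_mat D' D'" "Y \<in> carrier_mat D' D'" for X Y
    using \<phi>[of "pr X @ pr Y"] pr[OF that(1)] pr[OF that(2)] r r' by (simp add: poly_mat_append \<phi>_def)
  have \<phi>_smult: "\<phi> (c \<cdot>\<^sub>m X) = c \<cdot>\<^sub>m \<phi> X" if "X \<in> carrier_mat D' D'" for X c
    using \<phi>[of "poly_scale c (pr X)"] pr[OF that(1)] r r' by (simp add: poly_mat_scale \<phi>_def)
  have \<phi>_mult: "\<phi> (X * Y) = \<phi> X * \<phi> Y" if "X \<in> carrier_mat D' D'" "Y \<in> carrier_mat D' D'" for X Y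
    using \<phi>[of "poly_mult (pr X) (pr Y)"] pr[OF that(1)] pr[OF that(2)] r r' by (simp add: poly_mat_mult \<phi>_def)
  have \<phi>_gen: "\<phi> (N g) = M g" for g
  proof -
    have "poly_mat D' N [(1, [g])] = N g" "poly_mat D M [(1, [g])] = M g"
      using r r' by (auto simp: right_mult_one_mat[OF repD[OF r]] right_mult_one_mat[OF repD[OF r']])
    thus ?thesis using \<phi>[of "[(1, [g])]"] by simp
  qed
  have \<phi>_zero: "\<phi> (0\<^sub>m D' D') = 0\<^sub>m D D" using \<phi>[of "[]"] by simp
  define e where "e = (unit_vec D' 0 :: complex vec)"
  have e: "e \<in> carrier_vec D'" "e \<bullet> e = 1" unfolding e_def using D' by auto
  \<comment> \<open>If \<open>\<phi>\<close> killed all matrices \<open>y e^T\<close>, the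
    factorization \<open>y h^T = (y e^T) (e h^T)\<close> would make it kill everything, including
    each \<open>N g\<close>, whose image is \<open>M g\<close>.\<close>
  have "\<exists>y\<in>carrier_vec D'. \<phi> (outer y e) \<noteq> 0\<^sub>m D D"
  proof (rule ccontr)
    assume "\<not> ?thesis"
    hence z: "\<phi> (outer y e) = 0\<^sub>m D D" if "y \<in> carrier_vec D'" for y using that by auto
    define S where "S = {X \<in> carrier_mat D' D'. \<phi> X = 0\<^sub>m D D}"
    have "X \<in> S" if "X \<in> carrier_mat D' D'" for X
      using _ _ _ that
    proof (rule outer_span)
      show "0\<^sub>m D' D' \<in> S" unfolding S_def using \<phi>_zero by simp
      show "X + Y \<in> S" if "X \<in> S" "Y \<in> S" for X Y
        using that unfolding S_def by (auto simp: \<phi>_add)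
      fix y h :: "complex vec" assume yh: "y \<in> carrier_vec D'" "h \<in> carrier_vec D'"
      have "outer y h = outer y e * outer e h"
        using yh e by (subst outer_mult_outer[of _ D']) (auto intro!: eq_matI)
      hence "\<phi> (outer y h) = 0\<^sub>m D D * \<phi> (outer e h)"
        using yh e z by (simp add: \<phi>_mult)
      thus "outer y h \<in> S" unfolding S_def using yh by (simp add: left_mult_zero_mat[OF \<phi>c])
    qed
    hence "M g = 0\<^sub>m D D" for g using \<phi>_gen[of g] r' unfolding S_def by auto
    thus False using irredD(2)[OF M] by blast
  qed
  then obtain y where y: "y \<in> carrier_vec D'" "\<phi> (outer y e) \<noteq> 0\<^sub>m D D" by auto
  obtain v where v: "v \<in> carrier_vec D" "\<phi> (outer y e) *\<^sub>v v \<noteq> 0\<^sub>v D"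
  proof -
    have "\<exists>v\<in>carrier_vec D. \<phi> (outer y e) *\<^sub>v v \<noteq> 0\<^sub>v D"
    proof (rule ccontr)
      assume "\<not> ?thesis"
      hence "\<phi> (outer y e) = 0\<^sub>m D D" using \<phi>c by (intro mat_eq_by_vec[of _ D D]) auto
      thus False using y(2) by simp
    qed
    thus ?thesis using that by blast
  qed
  have o_add: "outer (x + z) e = outer x e + outer z e" if "x \<in> carrier_vec D'" "z \<in> carrier_vec D'" for x z
    using that by (intro eq_matI) (auto simp: outer_def distrib_right)
  have o_smult: "outer (c \<cdot>\<^sub>v x) e = c \<cdot>\<^sub>m outer x e" for x c
    by (intro eq_matI) (auto simp: outer_def)
  have "\<exists>T\<in>carrier_mat D D'. \<forall>x\<in>carrier_vec D'. T *\<^sub>v x = \<phi> (outer x e) *\<^sub>v v"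
  proof (rule linear_map_matrix)
    show "\<phi> (outer x e) *\<^sub>v v \<in> carrier_vec D" for x
      using \<phi>c v by (auto intro: mult_mat_vec_carrier[of _ D D])
    show "\<phi> (outer (x + z) e) *\<^sub>v v = \<phi> (outer x e) *\<^sub>v v + \<phi> (outer z e) *\<^sub>v v"
      if "x \<in> carrier_vec D'" "z \<in> carrier_vec D'" for x z
      using that e v \<phi>c by (simp add: o_add \<phi>_add add_mult_distrib_mat_vec[of _ D D])
    show "\<phi> (outer (c \<cdot>\<^sub>v x) e) *\<^sub>v v = c \<cdot>\<^sub>v (\<phi> (outer x e) *\<^sub>v v)" if "x \<in> carrier_vec D'" for c x
      using that e v \<phi>c by (simp add: o_smult \<phi>_smult smult_mat_mult_vec[of _ D D])
  qed
  then obtain T where T: "T \<in> carrier_mat D D'"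
    "\<And>x. x \<in> carrier_vec D' \<Longrightarrow> T *\<^sub>v x = \<phi> (outer x e) *\<^sub>v v" by blast
  have "M g * T = T * N g" for g
  proof (rule mat_eq_by_vec)
    fix x :: "complex vec" assume x: "x \<in> carrier_vec D'"
    have Nx: "N g *\<^sub>v x \<in> carrier_vec D'" using r' x by (auto intro: mult_mat_vec_carrier[of _ D' D'])
    have "(M g * T) *\<^sub>v x = M g *\<^sub>v (\<phi> (outer x e) *\<^sub>v v)"
      using T x r by (simp add: assoc_mult_mat_vec[of _ D D _ D'])
    also have "\<dots> = (\<phi> (N g) * \<phi> (outer x e)) *\<^sub>v v"
      using \<phi>_gen r \<phi>c v by (simp add: assoc_mult_mat_vec[of _ D D _ D])
    \<comment> \<open>Left multiplication by \<open>N g\<close> acts on the column of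
      \<open>y e^T\<close> as it does on the vector \<open>y\<close>; this is what makes
      \<open>T\<close> an intertwiner.\<close>
    also have "\<dots> = \<phi> (outer (N g *\<^sub>v x) e) *\<^sub>v v"
      using r' x e \<phi>_mult[of "N g" "outer x e"] mult_outer[of "N g" D' D' x e] by simp
    also have "\<dots> = T *\<^sub>v (N g *\<^sub>v x)" using T(2)[OF Nx] by simp
    also have "\<dots> = (T * N g) *\<^sub>v x" using T(1) r' x by (simp add: assoc_mult_mat_vec[of _ D D' _ D'])
    finally show "(M g * T) *\<^sub>v x = (T * N g) *\<^sub>v x" .
  qed (use T(1) r r' in \<open>auto intro: mult_carrier_mat[of _ D D] mult_carrier_mat[of _ D D']\<close>)
  moreover have "T \<noteq> 0\<^sub>m D D'"
  proof
    assume "T = 0\<^sub>m D D'"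
    hence "\<phi> (outer y e) *\<^sub>v v = 0\<^sub>v D" using T(2)[OF y(1)] y(1) by simp
    thus False using v by simp
  qed
  ultimately show False using schur[OF M N T(1)] ne by auto
qed

section \<open>Traces of polynomials and selection of one equivalence class\<close>

lemma poly_mat_intertwine:
  assumes r: "rep D M" "rep D' N" and T: "T \<in> carrier_mat D D'" "\<And>g. M g * T = T * N g"
  shows "poly_mat D M p * T = T * poly_mat D' N p"
proof (induction p)
  case Nil
  show ?case using T(1) by (simp add: left_mult_zero_mat[of _ D D'] right_mult_zero_mat[of _ D D'])
next
  case (Cons m p)
  have w: "word_mat D M w * T = T * word_mat D' N w" for w
  proof (induction w)
    case Nil
    show ?case using T(1) by (simp add: left_mult_one_mat[of _ D D'] right_mult_one_mat[of _ D D'])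
  next
    case (Cons g w)
    have "M g * word_mat D M w * T = M g * (T * word_mat D' N w)"
      using r T(1) Cons by (simp add: assoc_mult_mat[of _ D D _ D _ D'])
    also have "\<dots> = (M g * T) * word_mat D' N w"
      using r T(1) by (simp add: assoc_mult_mat[of _ D D _ D' _ D'])
    also have "\<dots> = T * (N g * word_mat D' N w)"
      unfolding T(2) using r T(1) by (simp add: assoc_mult_mat[of _ D D' _ D' _ D'])
    finally show ?case by simp
  qed
  show ?case
    using r T(1) Cons w[of "snd m"]
    by (simp add: add_mult_distrib_mat[of _ D D _ _ D'] mult_add_distrib_mat[of _ D D' _ D']
      mult_smult_assoc_mat[of _ D D _ D'] mult_smult_distrib[of _ D D' _ D'])
qed

lemma equiv_rep_trace:
  assumes r: "rep D M" "rep D' N" and e: "equiv_rep D M D' N"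
  shows "mat_trace (poly_mat D' N p) = mat_trace (poly_mat D M p)"
proof -
  obtain T T' where D: "D' = D" and T: "inverse_matrices D T T'" "\<And>g. M g * T = T * N g"
    using e unfolding equiv_rep_def by auto
  note Ti = inverse_matricesD[OF T(1)]
  have Nc: "poly_mat D N p \<in> carrier_mat D D" and Mc: "poly_mat D M p \<in> carrier_mat D D"
    using r D by auto
  have "poly_mat D N p = (T' * T) * poly_mat D N p" using Ti(4) left_mult_one_mat[OF Nc] by simp
  also have "\<dots> = T' * (T * poly_mat D N p)" by (rule assoc_mult_mat[OF Ti(2,1) Nc])
  also have "T * poly_mat D N p = poly_mat D M p * T"
    using poly_mat_intertwine[OF r(1) _ Ti(1) T(2), of p] r(2) unfolding D by simp
  finally have "mat_trace (poly_mat D N p) = mat_trace (T' * (poly_mat D M p * T))" by simp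
  also have "\<dots> = mat_trace (poly_mat D M p * T * T')"
    using Ti Mc by (intro mat_trace_comm[of _ D D]) auto
  also have "poly_mat D M p * T * T' = poly_mat D M p"
    using Ti Mc by (simp add: assoc_mult_mat[of _ D D _ D _ D] right_mult_one_mat[of _ D D])
  finally show ?thesis using D by simp
qed

lemma mat_mult_unit_vec:
  "A \<in> carrier_mat m n \<Longrightarrow> j < n \<Longrightarrow> A *\<^sub>v unit_vec n j = (col A j :: complex vec)"
  by (intro eq_vecI) auto

text \<open>The value at \<open>M\<close> is held at the idempotent \<open>e e^T\<close>, so
  multiplying by a further polynomial with this value changes nothing at \<open>M\<close> and keeps
  the zeros already obtained.\<close>

lemma irred_select:
  assumes M: "irred D M" and "\<And>D' N. (D', N) \<in> set Ws \<Longrightarrow> irred D' N \<and> \<not> equiv_rep D M D' N"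
  shows "\<exists>p. nonconst p \<and> mat_trace (poly_mat D M p) = 1 \<and>
    (\<forall>(D', N)\<in>set Ws. poly_mat D' N p = 0\<^sub>m D' D')"
proof -
  note r = irredD(1)[OF M]
  define e where "e = (unit_vec D 0 :: complex vec)"
  have e: "e \<in> carrier_vec D" "e \<bullet> e = 1" unfolding e_def using irred_dim_pos[OF M] by auto
  have poly: "\<exists>p. nonconst p \<and> poly_mat D M p = X" if "X \<in> carrier_mat D D" for X
    using that irred_alg_eq_carrier[OF M] unfolding alg_def by (metis (mono_tags, lifting) imageE mem_Collect_eq)
  have oe: "outer e e \<in> carrier_mat D D" using e by simp
  have ee: "outer e e * outer e e = outer e e"
    using e by (simp add: outer_mult_outer[of _ D])
  have "\<exists>p. nonconst p \<and> poly_mat D M p = outer e e \<and>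
    (\<forall>(D', N)\<in>set Ws. poly_mat D' N p = 0\<^sub>m D' D')"
    using assms(2)
  proof (induction Ws)
    case Nil
    thus ?case using poly[OF oe] by auto
  next
    case (Cons W Ws)
    obtain D' N where W: "W = (D', N)" by (cases W)
    obtain p where p: "nonconst p" "poly_mat D M p = outer e e"
      "\<forall>(D', N)\<in>set Ws. poly_mat D' N p = 0\<^sub>m D' D'" using Cons by auto
    have N: "irred D' N" "\<not> equiv_rep D M D' N" using Cons.prems[of D' N] W by auto
    note r' = irredD(1)[OF N(1)]
    obtain q where q: "nonconst q" "poly_mat D' N q = 0\<^sub>m D' D'" "poly_mat D M q \<noteq> 0\<^sub>m D D"
      using irred_separation[OF M N] by auto
    have qc: "poly_mat D M q \<in> carrier_mat D D" using r by simp
    have cc: "col (poly_mat D M q) j \<in> carrier_vec D" for j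
      using carrier_matD[OF qc] by (intro carrier_vecI) simp
    obtain i j where ij: "i < D" "j < D" "poly_mat D M q $$ (i, j) \<noteq> 0"
    proof -
      have "\<exists>i<D. \<exists>j<D. poly_mat D M q $$ (i, j) \<noteq> 0"
      proof (rule ccontr)
        assume "\<not> ?thesis"
        hence "poly_mat D M q = 0\<^sub>m D D" using carrier_matD[OF qc] by (intro eq_matI) auto
        thus False using q(3) by simp
      qed
      thus ?thesis using that by blast
    qed
    define c where "c = poly_mat D M q $$ (i, j)"
    obtain a where a: "nonconst a" "poly_mat D M a = outer e (unit_vec D i)"
      using poly[of "outer e (unit_vec D i)"] e by auto
    obtain b where b: "nonconst b" "poly_mat D M b = outer (unit_vec D j) e"
      using poly[of "outer (unit_vec D j) e"] e by auto
    \<comment> \<open>Flanking \<open>q\<close> by \<open>e e_i^T\<close> and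
      \<open>e_j e^T\<close>, both available at \<open>M\<close> by Burnside's theorem, extracts the
      nonzero entry \<open>c\<close>, while the zero of \<open>q\<close> at \<open>N\<close>
      survives.\<close>
    define s where "s = poly_scale (1 / c) (poly_mult a (poly_mult q b))"
    have "poly_mat D M q * outer (unit_vec D j) e = outer (col (poly_mat D M q) j) e"
      using qc ij by (simp add: mult_outer[OF qc] mat_mult_unit_vec[OF qc])
    hence "poly_mat D M (poly_mult a (poly_mult q b)) = outer e (unit_vec D i) * outer (col (poly_mat D M q) j) e"
      using r a b by (simp add: poly_mat_mult)
    also have "\<dots> = (unit_vec D i \<bullet> col (poly_mat D M q) j) \<cdot>\<^sub>m outer e e"
      using cc by (intro outer_mult_outer[of _ D]) auto
    also have "unit_vec D i \<bullet> col (poly_mat D M q) j = c"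
      using scalar_prod_left_unit[OF cc ij(1)] ij carrier_matD[OF qc] by (simp add: c_def)
    finally have sM: "poly_mat D M s = outer e e"
      using ij(3) r unfolding s_def c_def[symmetric] by (simp add: poly_mat_scale smult_smult_mat)
    have sN: "poly_mat D' N s = 0\<^sub>m D' D'"
      unfolding s_def using r' q(2)
      by (simp add: poly_mat_scale poly_mat_mult left_mult_zero_mat[OF poly_mat_carrier[OF r']]
        right_mult_zero_mat[OF poly_mat_carrier[OF r']])
    have s: "nonconst s" unfolding s_def using a b q by simp
    have "poly_mat D'' N' (poly_mult p s) = 0\<^sub>m D'' D''" if in_set: "(D'', N') \<in> set (W # Ws)" for D'' N'
    proof -
      have r'': "rep D'' N'" using Cons.prems[OF in_set] by (simp add: irredD(1))
      show ?thesis
      proof (cases "(D'', N') = W")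
        case True
        hence "D'' = D'" "N' = N" using W by auto
        thus ?thesis using sN
          by (simp add: poly_mat_mult[OF r'] right_mult_zero_mat[OF poly_mat_carrier[OF r']])
      next
        case False
        hence "poly_mat D'' N' p = 0\<^sub>m D'' D''" using in_set p(3) by auto
        thus ?thesis
          by (simp add: poly_mat_mult[OF r''] left_mult_zero_mat[OF poly_mat_carrier[OF r'']])
      qed
    qed
    hence "\<forall>(D', N)\<in>set (W # Ws). poly_mat D' N (poly_mult p s) = 0\<^sub>m D' D'" by blast
    moreover have "poly_mat D M (poly_mult p s) = outer e e"
      using poly_mat_mult[OF r, of p s] p(2) sM ee by simp
    moreover have "nonconst (poly_mult p s)" using p(1) by simp
    ultimately show ?case by blast
  qed
  then obtain p where p: "nonconst p" "poly_mat D M p = outer e e"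
    "\<forall>(D', N)\<in>set Ws. poly_mat D' N p = 0\<^sub>m D' D'" by blast
  have "mat_trace (poly_mat D M p) = 1" unfolding p(2) using mat_trace_outer[OF e(1) e(1)] e(2) by simp
  thus ?thesis using p(1,3) by blast
qed

lemma poly_trace_eq:
  assumes r: "\<And>D M. (D, M) \<in> set xs \<Longrightarrow> rep D M" "\<And>D M. (D, M) \<in> set ys \<Longrightarrow> rep D M"
    and tr: "\<And>w. w \<noteq> [] \<Longrightarrow> (\<Sum>(D, M)\<leftarrow>xs. mat_trace (word_mat D M w)) = (\<Sum>(D, M)\<leftarrow>ys. mat_trace (word_mat D M w))"
    and p: "nonconst p"
  shows "(\<Sum>(D, M)\<leftarrow>xs. mat_trace (poly_mat D M p)) = (\<Sum>(D, M)\<leftarrow>ys. mat_trace (poly_mat D M p))"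
proof -
  have step: "(\<Sum>(D, M)\<leftarrow>zs. mat_trace (poly_mat D M (m # p))) =
    fst m * (\<Sum>(D, M)\<leftarrow>zs. mat_trace (word_mat D M (snd m))) + (\<Sum>(D, M)\<leftarrow>zs. mat_trace (poly_mat D M p))"
    if "\<And>D M. (D, M) \<in> set zs \<Longrightarrow> rep D M" for zs :: "(nat \<times> ('a \<Rightarrow> complex mat)) list" and m p
    using that
  proof (induction zs)
    case (Cons z zs)
    obtain D M where z: "z = (D, M)" by (cases z)
    have "rep D M" using Cons.prems z by auto
    hence "mat_trace (poly_mat D M (m # p)) = fst m * mat_trace (word_mat D M (snd m)) + mat_trace (poly_mat D M p)"
      by (simp add: mat_trace_add[of _ D] mat_trace_smult[of _ D])
    moreover have "\<And>D M. (D, M) \<in> set zs \<Longrightarrow> rep D M" using Cons.prems by auto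
    ultimately show ?case using Cons.IH z by (simp add: distrib_left)
  qed simp
  have base: "(\<Sum>(D, M)\<leftarrow>zs. mat_trace (poly_mat D M [])) = 0" for zs :: "(nat \<times> ('a \<Rightarrow> complex mat)) list"
    by (induction zs) auto
  show ?thesis using p
  proof (induction p)
    case (Cons m p)
    thus ?case using step[OF r(1), where m = m and p = p] step[OF r(2), where m = m and p = p] tr[of "snd m"]
      by (simp del: poly_mat.simps)
  qed (simp add: base del: poly_mat.simps)
qed

text \<open>The selecting polynomial has trace 1 on each entry equivalent to \<open>M\<close> and 0
  on the others, so its total trace over \<open>xs\<close> counts the equivalents of
  \<open>M\<close>. In characteristic zero this positive count cannot agree with the total 0 over
  \<open>ys\<close>.\<close>

theorem irred_match:
  assumes xs: "\<And>D M. (D, M) \<in> set xs \<Longrightarrow> irred D M" and ys: "\<And>D M. (D, M) \<in> set ys \<Longrightarrow> irred D M"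
    and tr: "\<And>w. w \<noteq> [] \<Longrightarrow> (\<Sum>(D, M)\<leftarrow>xs. mat_trace (word_mat D M w)) = (\<Sum>(D, M)\<leftarrow>ys. mat_trace (word_mat D M w))"
    and x: "(D, M) \<in> set xs"
  shows "\<exists>(D', N)\<in>set ys. equiv_rep D M D' N"
proof (rule ccontr)
  assume no: "\<not> ?thesis"
  let ?eq = "\<lambda>(D', N). equiv_rep D M D' N"
  have M: "irred D M" using xs x by auto
  have "\<exists>p. nonconst p \<and> mat_trace (poly_mat D M p) = 1 \<and>
    (\<forall>(D', N)\<in>set (filter (\<lambda>z. \<not> ?eq z) xs @ ys). poly_mat D' N p = 0\<^sub>m D' D')"
  proof (rule irred_select[OF M])
    fix D' N assume "(D', N) \<in> set (filter (\<lambda>z. \<not> ?eq z) xs @ ys)"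
    thus "irred D' N \<and> \<not> equiv_rep D M D' N" using xs[of D' N] ys[of D' N] no by auto
  qed
  then obtain p where p: "nonconst p" "mat_trace (poly_mat D M p) = 1"
    "\<And>D' N. (D', N) \<in> set xs \<Longrightarrow> \<not> equiv_rep D M D' N \<Longrightarrow> poly_mat D' N p = 0\<^sub>m D' D'"
    "\<And>D' N. (D', N) \<in> set ys \<Longrightarrow> poly_mat D' N p = 0\<^sub>m D' D'" by auto
  have "map (\<lambda>(D, M). mat_trace (poly_mat D M p)) ys = map (\<lambda>z. 0) ys"
    using p(4) by auto
  hence y0: "(\<Sum>(D, M)\<leftarrow>ys. mat_trace (poly_mat D M p)) = 0" by (metis sum_list_0)
  have "(\<Sum>(D, M)\<leftarrow>xs. mat_trace (poly_mat D M p)) = (\<Sum>z\<leftarrow>xs. if ?eq z then 1 else 0)"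
  proof (rule arg_cong[of _ _ sum_list], rule map_cong[OF refl])
    fix z assume z: "z \<in> set xs"
    obtain D' N where [simp]: "z = (D', N)" by (cases z)
    have "irred D' N" using xs z by simp
    thus "(case z of (D, M) \<Rightarrow> mat_trace (poly_mat D M p)) = (if ?eq z then 1 else 0)"
      using p(2) p(3)[of D' N] z equiv_rep_trace[OF irredD(1)[OF M] irredD(1), of D' N p] by auto
  qed
  also have "\<dots> = of_nat (length (filter ?eq xs))" by (induction xs) auto
  finally have "length (filter ?eq xs) = 0"
    using poly_trace_eq[OF irredD(1)[OF xs] irredD(1)[OF ys] tr p(1)] y0 by simp
  thus False using x equiv_rep_refl[OF irredD(1)[OF M]] by (auto simp: filter_empty_conv)
qed

section \<open>Graded irreducible tensors\<close>

text \<open>A graded tensor is a single family indexed by \<open>'n option\<close>, with the parity operator at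
  \<open>None\<close>.\<close>

definition graded_irred :: "('n::finite \<Rightarrow> nat) \<Rightarrow> nat \<Rightarrow> ('n option \<Rightarrow> complex mat) \<Rightarrow> bool" where
  "graded_irred par D F \<longleftrightarrow> even_tensor par D (\<lambda>n. F (Some n)) (F None) \<and>
     (\<exists>n. F (Some n) \<noteq> 0\<^sub>m D D) \<and>
     (\<forall>W. lin_subspace D W \<and> (\<forall>g. \<forall>w\<in>W. F g *\<^sub>v w \<in> W) \<longrightarrow> W = {0\<^sub>v D} \<or> W = carrier_vec D)"

lemma diagonal_signs_square:
  assumes Z: "Z \<in> carrier_mat D D" and d: "diagonal_mat Z" and s: "\<forall>i<D. Z $$ (i, i) \<in> {1, -1 :: complex}"
  shows "Z * Z = 1\<^sub>m D"
proof (rule eq_matI)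
  fix i j assume "i < dim_row (1\<^sub>m D)" "j < dim_col (1\<^sub>m D)"
  hence ij: "i < D" "j < D" by auto
  have "(Z * Z) $$ (i, j) = (\<Sum>k<D. Z $$ (i, k) * Z $$ (k, j))"
    using Z ij by (simp add: scalar_prod_def atLeast0LessThan)
  also have "\<dots> = (\<Sum>k<D. if k = i then Z $$ (i, i) * Z $$ (i, j) else 0)"
    using Z d ij by (intro sum.cong) (auto simp: diagonal_mat_def)
  also have "\<dots> = Z $$ (i, i) * Z $$ (i, j)" using ij by (simp add: sum.delta)
  also have "\<dots> = 1\<^sub>m D $$ (i, j)"
    using Z d s[rule_format, OF ij(1)] ij by (cases "i = j") (auto simp: diagonal_mat_def)
  finally show "(Z * Z) $$ (i, j) = 1\<^sub>m D $$ (i, j)" .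
qed (use Z in auto)

lemma graded_irredD:
  assumes "graded_irred par D F"
  shows "rep D F" "F None * F None = 1\<^sub>m D" "diagonal_mat (F None)" "i < D \<Longrightarrow> F None $$ (i, i) \<in> {1, -1}"
    "F None * F (Some n) = (-1) ^ par n \<cdot>\<^sub>m (F (Some n) * F None)"
    "\<exists>n. F (Some n) \<noteq> 0\<^sub>m D D"
    "lin_subspace D W \<Longrightarrow> (\<And>g w. w \<in> W \<Longrightarrow> F g *\<^sub>v w \<in> W) \<Longrightarrow> W = {0\<^sub>v D} \<or> W = carrier_vec D"
proof -
  have "F g \<in> carrier_mat D D" for g
    using assms unfolding graded_irred_def even_tensor_def by (cases g) auto
  thus "rep D F" unfolding rep_def by simp
qed (use assms diagonal_signs_square[of "F None" D] in \<open>auto simp: graded_irred_def even_tensor_def\<close>)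

text \<open>The reversal preserves every relation imposed on a parity operator and every word in the
  \<open>A^n\<close>, so traces of such words cannot detect it.\<close>

definition flip_parity :: "('n option \<Rightarrow> complex mat) \<Rightarrow> 'n option \<Rightarrow> complex mat" where
  "flip_parity F g = (case g of None \<Rightarrow> (-1) \<cdot>\<^sub>m F None | Some n \<Rightarrow> F (Some n))"

lemma flip_parity_simps [simp]:
  "flip_parity F None = (-1) \<cdot>\<^sub>m F None" "flip_parity F (Some n) = F (Some n)"
  by (auto simp: flip_parity_def)

lemma graded_irred_flip:
  assumes F: "graded_irred par D F"
  shows "graded_irred par D (flip_parity F)"
proof -
  note G = graded_irredD[OF F]
  have c: "F g \<in> carrier_mat D D" for g using G(1) by simp
  have "even_tensor par D (\<lambda>n. flip_parity F (Some n)) (flip_parity F None)"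
    unfolding even_tensor_def
  proof (intro conjI allI impI)
    show "diagonal_mat (flip_parity F None)"
      using G(3) carrier_matD[OF c[of None]] by (auto simp: diagonal_mat_def)
    show "flip_parity F None $$ (i, i) \<in> {1, -1}" if "i < D" for i
      using G(4)[OF that] that carrier_matD[OF c[of None]] by auto
    show "flip_parity F None * flip_parity F (Some n) =
      (-1) ^ par n \<cdot>\<^sub>m (flip_parity F (Some n) * flip_parity F None)" for n
      using G(5)[of n] mult_smult_assoc_mat[OF c[of None] c[of "Some n"], of "-1"]
        mult_smult_distrib[OF c[of "Some n"] c[of None], of "-1"]
      by (simp add: smult_smult_mat mult.commute)
  qed (use c in auto)
  moreover have "W = {0\<^sub>v D} \<or> W = carrier_vec D"
    if W: "lin_subspace D W" "\<forall>g. \<forall>w\<in>W. flip_parity F g *\<^sub>v w \<in> W" for W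
  proof (rule G(7)[OF W(1)])
    fix g w assume w: "w \<in> W"
    show "F g *\<^sub>v w \<in> W"
    proof (cases g)
      case None
      have "(-1) \<cdot>\<^sub>v (((-1) \<cdot>\<^sub>m F None) *\<^sub>v w) = F None *\<^sub>v w"
        using lin_subspaceD(1)[OF W(1) w] c
        by (simp add: smult_mat_mult_vec[of _ D D] smult_smult_assoc)
      thus ?thesis using lin_subspaceD(4)[OF W(1), of "((-1) \<cdot>\<^sub>m F None) *\<^sub>v w" "-1"] W(2) w None
        by (metis flip_parity_simps(1))
    next
      case (Some n)
      thus ?thesis using W(2) w by (metis flip_parity_simps(2))
    qed
  qed
  ultimately show ?thesis using G(6) unfolding graded_irred_def by auto
qed

text \<open>Every letter contains exactly one \<open>A^n\<close>. Were \<open>Z\<close> a letter by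
  itself, the nonempty word \<open>Z Z = 1\<close> would have the dimension as its trace, which is
  not among the given data.\<close>

definition parity_ext :: "('n option \<Rightarrow> complex mat) \<Rightarrow> 'n \<times> bool \<Rightarrow> complex mat" where
  "parity_ext F g = (if snd g then F (Some (fst g)) * F None else F (Some (fst g)))"

text \<open>The parity operator commutes with each \<open>A^n\<close> up to sign, so it preserves
  the common kernel and graded irreducibility applies.\<close>

lemma graded_irred_common_kernel:
  assumes F: "graded_irred par D F" and v: "v \<in> carrier_vec D" "\<And>n. F (Some n) *\<^sub>v v = 0\<^sub>v D"
  shows "v = 0\<^sub>v D"
proof (rule ccontr)
  assume v0: "v \<noteq> 0\<^sub>v D"
  note G = graded_irredD[OF F]
  have c: "F g \<in> carrier_mat D D" for g using G(1) by simp
  define U where "U = {x \<in> carrier_vec D. \<forall>n. F (Some n) *\<^sub>v x = 0\<^sub>v D}"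
  have "lin_subspace D U" unfolding lin_subspace_def U_def using c
    by (auto simp: mult_add_distrib_mat_vec[of _ D D] mult_mat_vec[of _ D D] mat_mult_zero_vec[of _ D D])
  moreover have "F g *\<^sub>v w \<in> U" if w: "w \<in> U" for g w
  proof (cases g)
    case (Some n)
    thus ?thesis using w mat_mult_zero_vec[OF c] unfolding U_def by auto
  next
    case None
    have wc: "w \<in> carrier_vec D" using w unfolding U_def by auto
    have "F (Some n) *\<^sub>v (F None *\<^sub>v w) = 0\<^sub>v D" for n
    proof -
      have "(-1) ^ par n \<cdot>\<^sub>v (F (Some n) *\<^sub>v (F None *\<^sub>v w)) = ((-1) ^ par n \<cdot>\<^sub>m (F (Some n) * F None)) *\<^sub>v w"
        using c wc by (simp add: smult_mat_mult_vec[OF mult_carrier_mat[OF c c]] assoc_mult_mat_vec[OF c c])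
      also have "\<dots> = F None *\<^sub>v (F (Some n) *\<^sub>v w)"
        using G(5)[of n] c wc by (metis assoc_mult_mat_vec)
      also have "\<dots> = 0\<^sub>v D" using w mat_mult_zero_vec[OF c] unfolding U_def by auto
      \<comment> \<open>The sign squares to 1, so applying it once more removes it.\<close>
      finally have "(-1) ^ par n \<cdot>\<^sub>v ((-1) ^ par n \<cdot>\<^sub>v (F (Some n) *\<^sub>v (F None *\<^sub>v w))) = (-1) ^ par n \<cdot>\<^sub>v 0\<^sub>v D" by simp
      thus ?thesis by (simp add: smult_smult_assoc flip: power_mult_distrib)
    qed
    thus ?thesis using None wc c unfolding U_def by (auto intro: mult_mat_vec_carrier[of _ D D])
  qed
  ultimately have "U = {0\<^sub>v D} \<or> U = carrier_vec D" by (rule G(7))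
  moreover have "v \<in> U" unfolding U_def using v by auto
  ultimately have U: "U = carrier_vec D" using v0 by auto
  have "F (Some n) = 0\<^sub>m D D" for n
    using c U by (intro mat_eq_by_vec[of _ D D]) (auto simp: U_def)
  thus False using G(6) by blast
qed

text \<open>For an invariant \<open>W\<close> of the extended family, \<open>W \<inter> Z W\<close> is a graded invariant subspace.\<close>

lemma irred_parity_ext:
  assumes F: "graded_irred par D F"
  shows "irred D (parity_ext F)"
  unfolding irred_def
proof (intro conjI allI impI)
  note G = graded_irredD[OF F]
  have c: "F g \<in> carrier_mat D D" for g using G(1) by simp
  have e: "parity_ext F (n, False) = F (Some n)" "parity_ext F (n, True) = F (Some n) * F None" for n
    by (auto simp: parity_ext_def)
  show "rep D (parity_ext F)" unfolding rep_def parity_ext_def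
    using c by (auto intro: mult_carrier_mat[of _ D D])
  show "\<exists>g. parity_ext F g \<noteq> 0\<^sub>m D D"
  proof -
    obtain n where "parity_ext F (n, False) \<noteq> 0\<^sub>m D D" using G(6) by (auto simp: e)
    thus ?thesis by blast
  qed
  fix W assume W: "lin_subspace D W \<and> (\<forall>g. \<forall>w\<in>W. parity_ext F g *\<^sub>v w \<in> W)"
  hence sub: "lin_subspace D W" by simp
  note WD = lin_subspaceD[OF sub]
  have inv1: "F (Some n) *\<^sub>v w \<in> W" if "w \<in> W" for n w
  proof -
    have "parity_ext F (n, False) *\<^sub>v w \<in> W" using W that by blast
    thus ?thesis by (simp add: e)
  qed
  have inv2: "F (Some n) *\<^sub>v (F None *\<^sub>v w) \<in> W" if "w \<in> W" for n w
  proof -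
    have "parity_ext F (n, True) *\<^sub>v w \<in> W" using W that by blast
    thus ?thesis using c WD(1)[OF that] by (simp add: e assoc_mult_mat_vec[of _ D D _ D])
  qed
  have inv3: "F None *\<^sub>v (F (Some n) *\<^sub>v w) \<in> W" if "w \<in> W" for n w
  proof -
    have "F None *\<^sub>v (F (Some n) *\<^sub>v w) = (F None * F (Some n)) *\<^sub>v w"
      using c WD(1)[OF that] by (simp add: assoc_mult_mat_vec[of _ D D _ D])
    also have "\<dots> = (-1) ^ par n \<cdot>\<^sub>v (F (Some n) *\<^sub>v (F None *\<^sub>v w))"
      unfolding G(5) using c WD(1)[OF that]
      by (simp add: smult_mat_mult_vec[OF mult_carrier_mat[OF c c]] assoc_mult_mat_vec[OF c c])
    finally show ?thesis using WD(4) inv2[OF that] by simp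
  qed
  define U where "U = {w \<in> W. F None *\<^sub>v w \<in> W}"
  have "lin_subspace D U"
    unfolding lin_subspace_def U_def using WD c
    by (auto simp: mult_add_distrib_mat_vec[of _ D D] mult_mat_vec[of _ D D] mat_mult_zero_vec[of _ D D])
  moreover have "F g *\<^sub>v w \<in> U" if w: "w \<in> U" for g w
  proof (cases g)
    case None
    have "F None *\<^sub>v (F None *\<^sub>v w) = w"
      using assoc_mult_mat_vec[OF c c, of w None None] WD(1)[of w] w G(2) unfolding U_def by simp
    thus ?thesis using w None unfolding U_def by simp
  next
    case (Some n)
    thus ?thesis using w inv1 inv3 unfolding U_def by auto
  qed
  ultimately have "U = {0\<^sub>v D} \<or> U = carrier_vec D" by (rule G(7))
  thus "W = {0\<^sub>v D} \<or> W = carrier_vec D"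
  proof
    assume "U = carrier_vec D"
    thus ?thesis using WD(1) unfolding U_def by auto
  next
    assume U: "U = {0\<^sub>v D}"
    \<comment> \<open>For \<open>w\<close> in \<open>W\<close>, both \<open>A^n w\<close> and
      \<open>Z A^n w\<close> lie in \<open>W\<close>, so \<open>A^n w\<close> lies in
      \<open>U\<close>; a trivial \<open>U\<close> therefore puts \<open>W\<close> inside the common
      kernel.\<close>
    have "w = 0\<^sub>v D" if w: "w \<in> W" for w
    proof (rule graded_irred_common_kernel[OF F WD(1)[OF w]])
      fix n
      have "F (Some n) *\<^sub>v w \<in> U" unfolding U_def using inv1[OF w] inv3[OF w] by simp
      thus "F (Some n) *\<^sub>v w = 0\<^sub>v D" using U by simp
    qed
    hence "W \<subseteq> {0\<^sub>v D}" by blast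
    thus ?thesis using WD(2) by blast
  qed
qed

text \<open>Write \<open>Z\<close> and \<open>Z'\<close> for the two parity operators. Intertwining
  both kinds of letters gives \<open>A^n (Z T - T Z') = 0\<close>, so the difference maps into the
  common kernel, which is trivial.\<close>

lemma equiv_rep_of_parity_ext:
  assumes F: "graded_irred par D F" and H: "graded_irred par D' H"
    and e: "equiv_rep D (parity_ext F) D' (parity_ext H)"
  shows "equiv_rep D F D' H"
proof -
  obtain T T' where D: "D' = D" and T: "inverse_matrices D T T'"
    "\<And>g. parity_ext F g * T = T * parity_ext H g" using e unfolding equiv_rep_def by auto
  note G = graded_irredD[OF F] and G' = graded_irredD[OF H] and Ti = inverse_matricesD(1)[OF T(1)]
  have c: "F g \<in> carrier_mat D D" "H g \<in> carrier_mat D D" for g using G(1) G'(1) D by auto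
  have S: "F (Some n) * T = T * H (Some n)" for n using T(2)[of "(n, False)"] by (simp add: parity_ext_def)
  have "F None * T = T * H None"
  proof (rule mat_eq_by_vec[OF mult_carrier_mat[OF c(1) Ti] mult_carrier_mat[OF Ti c(2)]])
    fix v :: "complex vec" assume v: "v \<in> carrier_vec D"
    define x where "x = (F None * T) *\<^sub>v v" define y where "y = (T * H None) *\<^sub>v v"
    have xy: "x \<in> carrier_vec D" "y \<in> carrier_vec D"
      unfolding x_def y_def
      using mult_mat_vec_carrier[OF mult_carrier_mat[OF c(1) Ti] v]
        mult_mat_vec_carrier[OF mult_carrier_mat[OF Ti c(2)] v] by auto
    have "F (Some n) *\<^sub>v (x - y) = 0\<^sub>v D" for n
    proof -
      have "F (Some n) * (F None * T) = F (Some n) * F None * T"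
        using c Ti by (simp add: assoc_mult_mat[of _ D D _ D _ D])
      also have "\<dots> = T * (H (Some n) * H None)" using T(2)[of "(n, True)"] by (simp add: parity_ext_def)
      also have "\<dots> = T * H (Some n) * H None" using c Ti by (simp add: assoc_mult_mat[of _ D D _ D _ D])
      also have "\<dots> = F (Some n) * (T * H None)"
        unfolding S[symmetric] using c Ti by (simp add: assoc_mult_mat[of _ D D _ D _ D])
      finally have eq: "F (Some n) * (F None * T) = F (Some n) * (T * H None)" .
      have "F (Some n) *\<^sub>v x = F (Some n) * (F None * T) *\<^sub>v v"
        unfolding x_def by (rule assoc_mult_mat_vec[OF c(1) mult_carrier_mat[OF c(1) Ti] v, symmetric])
      also have "\<dots> = F (Some n) *\<^sub>v y"
        unfolding y_def eq by (rule assoc_mult_mat_vec[OF c(1) mult_carrier_mat[OF Ti c(2)] v])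
      finally show ?thesis using c xy mult_mat_vec_carrier[OF c(1) xy(2)]
        by (simp add: mult_minus_distrib_mat_vec[of _ D D])
    qed
    hence xy0: "x - y = 0\<^sub>v D"
      using minus_carrier_vec[OF xy] graded_irred_common_kernel[OF F, of "x - y"] by blast
    have "x = y"
    proof (rule eq_vecI)
      fix i assume "i < dim_vec y"
      thus "x $ i = y $ i" using arg_cong[OF xy0, of "\<lambda>z. z $ i"] xy by simp
    qed (use xy in auto)
    thus "(F None * T) *\<^sub>v v = (T * H None) *\<^sub>v v" unfolding x_def y_def .
  qed
  hence "F g * T = T * H g" for g using S by (cases g) auto
  thus ?thesis unfolding equiv_rep_def using D T(1) by auto
qed

text \<open>The sign picked up when all parity operators move to the right end of a word: the one in
  letter \<open>g\<close> passes every later letter. It depends on the word and \<open>par\<close>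
  alone, hence is the same for all blocks of both tensors.\<close>

primrec word_sign :: "('n \<Rightarrow> nat) \<Rightarrow> ('n \<times> bool) list \<Rightarrow> complex" where
  "word_sign par [] = 1"
| "word_sign par (g # w) = word_sign par w * (if snd g then (-1) ^ (\<Sum>n\<leftarrow>map fst w. par n) else 1)"

lemma parity_word_commute:
  assumes F: "graded_irred par D F"
  shows "F None * word_mat D F (map Some w) =
    (-1) ^ (\<Sum>n\<leftarrow>w. par n) \<cdot>\<^sub>m (word_mat D F (map Some w) * F None)"
proof (induction w)
  case Nil
  thus ?case using graded_irredD(1)[OF F]
    by (simp add: left_mult_one_mat[of _ D D] right_mult_one_mat[of _ D D])
next
  case (Cons n w)
  note G = graded_irredD[OF F]
  let ?W = "word_mat D F (map Some w)"
  have c: "F g \<in> carrier_mat D D" "?W \<in> carrier_mat D D" for g using G(1) by auto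
  have "F None * (F (Some n) * ?W) = F None * F (Some n) * ?W"
    using c by (simp add: assoc_mult_mat[of _ D D _ D _ D])
  also have "\<dots> = (-1) ^ par n \<cdot>\<^sub>m (F (Some n) * F None * ?W)"
    unfolding G(5) by (rule mult_smult_assoc_mat[OF mult_carrier_mat[OF c(1) c(1)] c(2)])
  also have "F (Some n) * F None * ?W = F (Some n) * (F None * ?W)"
    using c by (simp add: assoc_mult_mat[of _ D D _ D _ D])
  also have "\<dots> = (-1) ^ (\<Sum>n\<leftarrow>w. par n) \<cdot>\<^sub>m (F (Some n) * (?W * F None))"
    unfolding Cons using c by (simp add: mult_smult_distrib[of _ D D _ D])
  also have "F (Some n) * (?W * F None) = F (Some n) * ?W * F None"
    using c by (simp add: assoc_mult_mat[of _ D D _ D _ D])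
  finally show ?case by (simp add: smult_smult_mat power_add)
qed

text \<open>Once moved to the right end, the parity operators multiply to the identity or to a
  single one of them, because they square to the identity.\<close>

lemma word_mat_parity_ext:
  assumes F: "graded_irred par D F"
  shows "word_mat D (parity_ext F) w = word_sign par w \<cdot>\<^sub>m
    (word_mat D F (map Some (map fst w)) * (if odd (length (filter snd w)) then F None else 1\<^sub>m D))"
proof (induction w)
  case Nil
  show ?case by (auto simp: right_mult_one_mat[of _ D D] intro!: eq_matI)
next
  case (Cons g w)
  note G = graded_irredD[OF F]
  obtain n b where g: "g = (n, b)" by (cases g)
  let ?W = "word_mat D F (map Some (map fst w))"
  let ?Z = "\<lambda>b. if b then F None else 1\<^sub>m D"
  let ?o = "odd (length (filter snd w))"
  have c: "F g \<in> carrier_mat D D" "?W \<in> carrier_mat D D" "?Z b \<in> carrier_mat D D" for g b using G(1) by auto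
  have ZW: "?Z b * ?W = (if b then (-1) ^ (\<Sum>n\<leftarrow>map fst w. par n) else 1) \<cdot>\<^sub>m (?W * ?Z b)"
    using parity_word_commute[OF F, of "map fst w"] c(2)
    by (auto simp: left_mult_one_mat[of _ D D] right_mult_one_mat[of _ D D] intro!: eq_matI)
  have ZZ: "?Z b * ?Z ?o = ?Z (odd (length (filter snd (g # w))))"
    using G(2) c by (auto simp: g left_mult_one_mat[of _ D D] right_mult_one_mat[of _ D D])
  have "parity_ext F g = F (Some n) * ?Z b"
    using c by (auto simp: g parity_ext_def right_mult_one_mat[of _ D D])
  hence "word_mat D (parity_ext F) (g # w) = F (Some n) * ?Z b * (word_sign par w \<cdot>\<^sub>m (?W * ?Z ?o))"
    using Cons by simp
  also have "\<dots> = word_sign par w \<cdot>\<^sub>m (F (Some n) * ?Z b * (?W * ?Z ?o))"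
    by (rule mult_smult_distrib[OF mult_carrier_mat[OF c(1) c(3)] mult_carrier_mat[OF c(2) c(3)]])
  also have "F (Some n) * ?Z b * (?W * ?Z ?o) = F (Some n) * (?Z b * ?W * ?Z ?o)"
    unfolding assoc_mult_mat[OF c(3) c(2) c(3)]
    by (rule assoc_mult_mat[OF c(1) c(3) mult_carrier_mat[OF c(2) c(3)]])
  also have "?Z b * ?W * ?Z ?o = (if b then (-1) ^ (\<Sum>n\<leftarrow>map fst w. par n) else 1) \<cdot>\<^sub>m (?W * ?Z b * ?Z ?o)"
    unfolding ZW by (rule mult_smult_assoc_mat[OF mult_carrier_mat[OF c(2) c(3)] c(3)])
  also have "?W * ?Z b * ?Z ?o = ?W * ?Z (odd (length (filter snd (g # w))))"
    unfolding ZZ[symmetric] by (rule assoc_mult_mat[OF c(2) c(3) c(3)])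
  also have "F (Some n) * ((if b then (-1) ^ (\<Sum>n\<leftarrow>map fst w. par n) else 1) \<cdot>\<^sub>m (?W * ?Z (odd (length (filter snd (g # w)))))) =
    (if b then (-1) ^ (\<Sum>n\<leftarrow>map fst w. par n) else 1) \<cdot>\<^sub>m (F (Some n) * (?W * ?Z (odd (length (filter snd (g # w))))))"
    by (rule mult_smult_distrib[OF c(1) mult_carrier_mat[OF c(2) c(3)]])
  also have "F (Some n) * (?W * ?Z (odd (length (filter snd (g # w))))) = F (Some n) * ?W * ?Z (odd (length (filter snd (g # w))))"
    by (rule assoc_mult_mat[OF c(1) c(2) c(3), symmetric])
  finally show ?case unfolding smult_smult_mat by (simp add: g)
qed

text \<open>Opposite signs of the parity operator cancel the odd words, whose traces the chain does
  not give; even words are insensitive to the sign and double.\<close>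

lemma trace_parity_ext:
  assumes F: "graded_irred par D F"
  shows "mat_trace (word_mat D (parity_ext F) w) + mat_trace (word_mat D (parity_ext (flip_parity F)) w) =
    (if odd (length (filter snd w)) then 0
     else 2 * word_sign par w * mat_trace (word_mat D F (map Some (map fst w))))"
proof -
  note G = graded_irredD[OF F]
  have W: "word_mat D (flip_parity F) (map Some v) = word_mat D F (map Some v)" for v
    by (induction v) auto
  let ?W = "word_mat D F (map Some (map fst w))"
  have c: "F None \<in> carrier_mat D D" "?W \<in> carrier_mat D D" using G(1) by auto
  show ?thesis
    unfolding word_mat_parity_ext[OF F] word_mat_parity_ext[OF graded_irred_flip[OF F]] W
    using c by (simp del: map_map add: mult_smult_distrib[OF c(2,1)] mat_trace_smult[of _ D] right_mult_one_mat[OF c(2)])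
qed

definition parity_variant :: "nat \<times> ('n option \<Rightarrow> complex mat) \<Rightarrow> nat \<times> ('n option \<Rightarrow> complex mat) \<Rightarrow> bool" where
  "parity_variant x y \<longleftrightarrow> y = x \<or> y = (fst x, flip_parity (snd x))"

text \<open>Listing every block with both signs makes the traces of extended words agree, so
  ordinary matching applies. The partner may be either copy of a block, hence the parity
  variant.\<close>

lemma graded_match:
  assumes xs: "\<And>D F. (D, F) \<in> set xs \<Longrightarrow> graded_irred par D F"
    and ys: "\<And>D F. (D, F) \<in> set ys \<Longrightarrow> graded_irred par D F"
    and tr: "\<And>w. w \<noteq> [] \<Longrightarrow> (\<Sum>(D, F)\<leftarrow>xs. mat_trace (word_mat D F (map Some w))) =
      (\<Sum>(D, F)\<leftarrow>ys. mat_trace (word_mat D F (map Some w)))"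
    and x: "(D, F) \<in> set xs"
  shows "\<exists>y\<in>set ys. \<exists>H. parity_variant y (D, H) \<and> equiv_rep D F D H"
proof -
  define dbl where "dbl zs = concat (map (\<lambda>(D, F). [(D, parity_ext F), (D, parity_ext (flip_parity F))]) zs)"
    for zs :: "(nat \<times> ('a option \<Rightarrow> complex mat)) list"
  have irr: "irred D M" if "\<And>D F. (D, F) \<in> set zs \<Longrightarrow> graded_irred par D F" "(D, M) \<in> set (dbl zs)" for zs D M
    using that irred_parity_ext graded_irred_flip unfolding dbl_def by fastforce
  have sum: "(\<Sum>(D, M)\<leftarrow>dbl zs. mat_trace (word_mat D M w)) =
    (if odd (length (filter snd w)) then 0
     else 2 * word_sign par w * (\<Sum>(D, F)\<leftarrow>zs. mat_trace (word_mat D F (map Some (map fst w)))))"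
    if "\<And>D F. (D, F) \<in> set zs \<Longrightarrow> graded_irred par D F" for zs w
    using that
  proof (induction zs)
    case (Cons z zs)
    obtain D F where z: "z = (D, F)" by (cases z)
    have "graded_irred par D F" using Cons.prems z by auto
    note t = trace_parity_ext[OF this, of w]
    have IH: "(\<Sum>(D, M)\<leftarrow>dbl zs. mat_trace (word_mat D M w)) =
      (if odd (length (filter snd w)) then 0
       else 2 * word_sign par w * (\<Sum>(D, F)\<leftarrow>zs. mat_trace (word_mat D F (map Some (map fst w)))))"
      using Cons.IH Cons.prems by auto
    have "(\<Sum>(D, M)\<leftarrow>dbl (z # zs). mat_trace (word_mat D M w)) =
      mat_trace (word_mat D (parity_ext F) w) + mat_trace (word_mat D (parity_ext (flip_parity F)) w) +
      (\<Sum>(D, M)\<leftarrow>dbl zs. mat_trace (word_mat D M w))"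
      by (simp add: dbl_def z)
    thus ?case unfolding t IH by (simp add: z distrib_left)
  qed (simp add: dbl_def)
  have x': "(D, parity_ext F) \<in> set (dbl xs)" using x unfolding dbl_def by force
  have tr': "(\<Sum>(D, M)\<leftarrow>dbl xs. mat_trace (word_mat D M w)) = (\<Sum>(D, M)\<leftarrow>dbl ys. mat_trace (word_mat D M w))"
    if "w \<noteq> []" for w
    using that sum[OF xs, where w = w] sum[OF ys, where w = w] tr[of "map fst w"] by simp
  have "\<exists>(D', N)\<in>set (dbl ys). equiv_rep D (parity_ext F) D' N"
    by (rule irred_match[OF irr[OF xs] irr[OF ys] tr' x'])
  then obtain D' N where N: "(D', N) \<in> set (dbl ys)" "equiv_rep D (parity_ext F) D' N" by auto
  then obtain H0 where H0: "(D', H0) \<in> set ys" "N = parity_ext H0 \<or> N = parity_ext (flip_parity H0)"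
    unfolding dbl_def by auto
  obtain H where H: "parity_variant (D', H0) (D', H)" "N = parity_ext H" "graded_irred par D' H"
    using H0(2) ys[OF H0(1)] graded_irred_flip unfolding parity_variant_def by auto
  have "D' = D" using N(2) unfolding equiv_rep_def by simp
  moreover have "equiv_rep D F D' H" using equiv_rep_of_parity_ext[OF xs[OF x] H(3)] N(2) H(2) by simp
  ultimately show ?thesis using H0(1) H(1) by blast
qed

section \<open>Direct sums\<close>

lemma equiv_rep_trans:
  assumes "rep D M" "rep D N" "rep D L" "equiv_rep D M D N" "equiv_rep D N D L"
  shows "equiv_rep D M D L"
proof -
  obtain S S' where S: "inverse_matrices D S S'" "\<And>g. M g * S = S * N g"
    using assms unfolding equiv_rep_def by auto
  obtain T T' where T: "inverse_matrices D T T'" "\<And>g. N g * T = T * L g"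
    using assms unfolding equiv_rep_def by auto
  note Si = inverse_matricesD[OF S(1)] and Ti = inverse_matricesD[OF T(1)]
  have c: "M g \<in> carrier_mat D D" "N g \<in> carrier_mat D D" "L g \<in> carrier_mat D D" for g using assms by auto
  note assoc = assoc_mult_mat[of _ D D _ D _ D]
  have "M g * (S * T) = S * T * L g" for g
  proof -
    have "M g * (S * T) = M g * S * T" using c Si Ti by (simp add: assoc)
    also have "\<dots> = S * (N g * T)" unfolding S(2) using c Si Ti by (simp add: assoc)
    also have "\<dots> = S * T * L g" unfolding T(2) using c Si Ti by (simp add: assoc)
    finally show ?thesis .
  qed
  moreover have "inverse_matrices D (S * T) (T' * S')"
  proof (rule inverse_matricesI)
    have "S * T * (T' * S') = S * (T * (T' * S'))"
      by (rule assoc_mult_mat[OF Si(1) Ti(1) mult_carrier_mat[OF Ti(2) Si(2)]])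
    also have "T * (T' * S') = T * T' * S'" by (rule assoc_mult_mat[OF Ti(1,2) Si(2), symmetric])
    also have "S * \<dots> = 1\<^sub>m D" unfolding Ti(3) using Si by (simp add: left_mult_one_mat[of _ D D])
    finally show "S * T * (T' * S') = 1\<^sub>m D" .
    have "T' * S' * (S * T) = T' * (S' * (S * T))"
      by (rule assoc_mult_mat[OF Ti(2) Si(2) mult_carrier_mat[OF Si(1) Ti(1)]])
    also have "S' * (S * T) = S' * S * T" by (rule assoc_mult_mat[OF Si(2,1) Ti(1), symmetric])
    also have "T' * \<dots> = 1\<^sub>m D" unfolding Si(4) using Ti by (simp add: left_mult_one_mat[of _ D D])
    finally show "T' * S' * (S * T) = 1\<^sub>m D" .
  qed (use Si Ti in auto)
  ultimately show ?thesis unfolding equiv_rep_def by auto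
qed

definition blk :: "complex mat \<Rightarrow> complex mat \<Rightarrow> complex mat" where
  "blk A B = four_block_mat A (0\<^sub>m (dim_row A) (dim_col B)) (0\<^sub>m (dim_row B) (dim_col A)) B"

lemma blk_carrier [simp]:
  "A \<in> carrier_mat m n \<Longrightarrow> B \<in> carrier_mat k l \<Longrightarrow> blk A B \<in> carrier_mat (m + k) (n + l)"
  unfolding blk_def by auto

lemma blk_mult:
  assumes "A \<in> carrier_mat m m" "A' \<in> carrier_mat m m" "B \<in> carrier_mat n n" "B' \<in> carrier_mat n n"
  shows "blk A B * blk A' B' = blk (A * A') (B * B')"
  unfolding blk_def using assms
  by (subst mult_four_block_mat[of _ m m _ n _ n]) (auto intro!: cong_four_block_mat)

lemma blk_one: "blk (1\<^sub>m m) (1\<^sub>m n) = 1\<^sub>m (m + n)"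
  unfolding blk_def by simp

lemma blk_assoc: "blk A (blk B C) = blk (blk A B) C"
  unfolding blk_def by (rule assoc_four_block_mat)

lemma mat_trace_blk:
  assumes "A \<in> carrier_mat m m" "B \<in> carrier_mat n n"
  shows "mat_trace (blk A B) = mat_trace A + mat_trace B"
proof -
  have split: "{..<m + n} = {..<m} \<union> (\<lambda>i. m + i) ` {..<n}"
    by (auto simp: image_iff) (metis add_diff_inverse_nat lessThan_iff nat_add_left_cancel_less)
  have "mat_trace (blk A B) = (\<Sum>i<m + n. if i < m then A $$ (i, i) else B $$ (i - m, i - m))"
    unfolding mat_trace_def blk_def using assms by (intro sum.cong) auto
  also have "\<dots> = (\<Sum>i<m. A $$ (i, i)) + (\<Sum>i<n. B $$ (i, i))"
    unfolding split by (subst sum.union_disjoint) (auto simp: sum.reindex)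
  finally show ?thesis using assms by (simp add: mat_trace_def)
qed

lemma rep_blk: "rep D M \<Longrightarrow> rep E N \<Longrightarrow> rep (D + E) (\<lambda>g. blk (M g) (N g))"
  unfolding rep_def by auto

lemma word_mat_blk:
  assumes "rep D M" "rep E N"
  shows "word_mat (D + E) (\<lambda>g. blk (M g) (N g)) w = blk (word_mat D M w) (word_mat E N w)"
  using assms by (induction w) (auto simp: blk_one blk_mult[of _ D _ _ E])

lemma equiv_rep_blk:
  assumes r: "rep D M" "rep D M'" "rep E N" "rep E N'"
    and e: "equiv_rep D M D M'" "equiv_rep E N E N'"
  shows "equiv_rep (D + E) (\<lambda>g. blk (M g) (N g)) (D + E) (\<lambda>g. blk (M' g) (N' g))"
proof -
  obtain S S' where S: "inverse_matrices D S S'" "\<And>g. M g * S = S * M' g"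
    using e(1) unfolding equiv_rep_def by auto
  obtain T T' where T: "inverse_matrices E T T'" "\<And>g. N g * T = T * N' g"
    using e(2) unfolding equiv_rep_def by auto
  note Si = inverse_matricesD[OF S(1)] and Ti = inverse_matricesD[OF T(1)]
  have "inverse_matrices (D + E) (blk S T) (blk S' T')"
    using Si Ti by (intro inverse_matricesI) (simp_all add: blk_mult[of _ D _ _ E] blk_one)
  moreover have "blk (M g) (N g) * blk S T = blk S T * blk (M' g) (N' g)" for g
    using Si Ti r S(2)[of g] T(2)[of g] by (simp add: blk_mult[of _ D _ _ E])
  ultimately show ?thesis unfolding equiv_rep_def by auto
qed

lemma equiv_rep_blk_commute:
  assumes r: "rep D M" "rep E N"
  shows "equiv_rep (D + E) (\<lambda>g. blk (M g) (N g)) (D + E) (\<lambda>g. blk (N g) (M g))"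
proof -
  \<comment> \<open>The matrix exchanging the two summands; its inverse is the same matrix with the
    dimensions exchanged.\<close>
  define T where "T m n = four_block_mat (0\<^sub>m m n) (1\<^sub>m m) (1\<^sub>m n) (0\<^sub>m n m :: complex mat)" for m n
  have Tc: "T m n \<in> carrier_mat (m + n) (n + m)" for m n unfolding T_def by simp
  have TT: "T m n * T n m = 1\<^sub>m (m + n)" for m n
    unfolding T_def by (subst mult_four_block_mat[of _ m n _ m _ n]) auto
  have "inverse_matrices (D + E) (T D E) (T E D)"
    using Tc[of D E] Tc[of E D] TT[of D E] TT[of E D]
    by (intro inverse_matricesI) (simp_all add: add.commute)
  moreover have "blk (M g) (N g) * T D E = T D E * blk (N g) (M g)" for g
  proof -
    have c: "M g \<in> carrier_mat D D" "N g \<in> carrier_mat E E" using r by auto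
    have "blk (M g) (N g) * T D E = four_block_mat (0\<^sub>m D E) (M g) (N g) (0\<^sub>m E D)"
      unfolding blk_def T_def using c
      by (subst mult_four_block_mat[of _ D D _ E _ E]) (auto intro!: cong_four_block_mat)
    also have "\<dots> = T D E * blk (N g) (M g)"
      unfolding blk_def T_def using c
      by (subst mult_four_block_mat[of _ D E _ D _ E]) (auto intro!: cong_four_block_mat)
    finally show ?thesis .
  qed
  ultimately show ?thesis unfolding equiv_rep_def by auto
qed

section \<open>Direct sums of lists of blocks and their matching\<close>

definition dsum_dim :: "(nat \<times> ('g \<Rightarrow> complex mat)) list \<Rightarrow> nat" where
  "dsum_dim xs = sum_list (map fst xs)"

definition dsum :: "(nat \<times> ('g \<Rightarrow> complex mat)) list \<Rightarrow> 'g \<Rightarrow> complex mat" where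
  "dsum xs g = diag_block_mat (map (\<lambda>x. snd x g) xs)"

lemma dsum_simps [simp]:
  "dsum_dim [] = 0" "dsum [] = (\<lambda>g. 0\<^sub>m 0 0)"
  "dsum_dim (x # xs) = fst x + dsum_dim xs" "dsum (x # xs) = (\<lambda>g. blk (snd x g) (dsum xs g))"
  by (auto simp: dsum_dim_def dsum_def blk_def Let_def fun_eq_iff)

lemma rep_dsum: "(\<And>D F. (D, F) \<in> set xs \<Longrightarrow> rep D F) \<Longrightarrow> rep (dsum_dim xs) (dsum xs)"
proof (induction xs)
  case (Cons x xs)
  thus ?case by (cases x) (auto intro!: rep_blk)
qed (simp add: rep_def)

lemma trace_word_dsum:
  assumes "\<And>D F. (D, F) \<in> set xs \<Longrightarrow> rep D F"
  shows "mat_trace (word_mat (dsum_dim xs) (dsum xs) w) = (\<Sum>(D, F)\<leftarrow>xs. mat_trace (word_mat D F w))"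
  using assms
proof (induction xs)
  case Nil
  have "rep 0 (\<lambda>g :: 'a. 0\<^sub>m 0 0 :: complex mat)" by (simp add: rep_def)
  hence "word_mat 0 (\<lambda>g. 0\<^sub>m 0 0) w \<in> carrier_mat 0 0" by simp
  thus ?case by (simp add: mat_trace_def)
next
  case (Cons x xs)
  obtain D F where x: "x = (D, F)" by (cases x)
  have "rep D F" "rep (dsum_dim xs) (dsum xs)" using Cons.prems x by (auto intro!: rep_dsum)
  thus ?case using Cons x by (simp add: word_mat_blk mat_trace_blk[of _ D _ "dsum_dim xs"])
qed

text \<open>An exchange of neighbours moves \<open>y\<close> past \<open>u\<close> with the
  remaining sum carried along; the induction hypothesis then acts behind \<open>u\<close>.\<close>

lemma dsum_middle:
  assumes "\<And>D F. (D, F) \<in> set (y # us @ vs) \<Longrightarrow> rep D F"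
  shows "dsum_dim (y # us @ vs) = dsum_dim (us @ y # vs) \<and>
    equiv_rep (dsum_dim (y # us @ vs)) (dsum (y # us @ vs)) (dsum_dim (us @ y # vs)) (dsum (us @ y # vs))"
  using assms
proof (induction us)
  case Nil
  thus ?case using equiv_rep_refl rep_dsum[of "y # vs"] by fastforce
next
  case (Cons u us)
  let ?r = "us @ vs"
  obtain D F where y: "y = (D, F)" by (cases y)
  obtain E H where u: "u = (E, H)" by (cases u)
  have r: "rep D F" "rep E H" "rep (dsum_dim ?r) (dsum ?r)"
    using Cons.prems y u by (auto intro!: rep_dsum)
  have IH: "dsum_dim (y # ?r) = dsum_dim (us @ y # vs)"
    "equiv_rep (dsum_dim (y # ?r)) (dsum (y # ?r)) (dsum_dim (us @ y # vs)) (dsum (us @ y # vs))"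
    using Cons.IH Cons.prems by auto
  let ?R = "dsum_dim ?r"
  have r2: "rep (D + ?R) (dsum (us @ y # vs))"
  proof -
    have "rep (dsum_dim (us @ y # vs)) (dsum (us @ y # vs))"
      using Cons.prems by (intro rep_dsum) auto
    thus ?thesis using IH(1) y by simp
  qed
  have "equiv_rep (D + E + ?R) (\<lambda>g. blk (blk (F g) (H g)) (dsum ?r g)) (D + E + ?R) (\<lambda>g. blk (blk (H g) (F g)) (dsum ?r g))"
  proof (rule equiv_rep_blk[OF rep_blk[OF r(1,2)] _ r(3,3) equiv_rep_blk_commute[OF r(1,2)] equiv_rep_refl[OF r(3)]])
    show "rep (D + E) (\<lambda>g. blk (H g) (F g))" using rep_blk[OF r(2,1)] by (simp add: add.commute)
  qed
  hence "equiv_rep (E + (D + ?R)) (\<lambda>g. blk (F g) (blk (H g) (dsum ?r g))) (E + (D + ?R)) (\<lambda>g. blk (H g) (blk (F g) (dsum ?r g)))"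
    by (simp add: blk_assoc ac_simps)
  moreover have "equiv_rep (E + (D + ?R)) (\<lambda>g. blk (H g) (blk (F g) (dsum ?r g))) (E + (D + ?R)) (\<lambda>g. blk (H g) (dsum (us @ y # vs) g))"
    using r r2 IH y rep_blk[OF r(1,3)] equiv_rep_refl[OF r(2)]
    by (intro equiv_rep_blk[of E H H "D + ?R" "\<lambda>g. blk (F g) (dsum ?r g)" "dsum (us @ y # vs)"]) auto
  moreover have "rep (E + (D + ?R)) (\<lambda>g. blk (F g) (blk (H g) (dsum ?r g)))"
    using rep_blk[OF r(1) rep_blk[OF r(2,3)]] by (simp add: ac_simps)
  moreover have "rep (E + (D + ?R)) (\<lambda>g. blk (H g) (blk (F g) (dsum ?r g)))"
    using rep_blk[OF r(2) rep_blk[OF r(1,3)]] .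
  moreover have "rep (E + (D + ?R)) (\<lambda>g. blk (H g) (dsum (us @ y # vs) g))"
    using rep_blk[OF r(2) r2] .
  ultimately have "equiv_rep (E + (D + ?R)) (\<lambda>g. blk (F g) (blk (H g) (dsum ?r g))) (E + (D + ?R)) (\<lambda>g. blk (H g) (dsum (us @ y # vs) g))"
    by (blast intro: equiv_rep_trans)
  moreover have "dsum_dim (us @ (D, F) # vs) = D + ?R" using IH(1) y by simp
  ultimately show ?case using y u by (simp add: ac_simps)
qed

lemma list_all2_preimage: "list_all2 R xs ys \<Longrightarrow> y \<in> set ys \<Longrightarrow> \<exists>x\<in>set xs. R x y"
  by (induction rule: list_all2_induct) auto

text \<open>Matched blocks are cancelled one pair at a time. The list \<open>zs\<close> keeps the
  order of \<open>ys\<close> and alters only parity operators, so its direct sum reproduces the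
  second tensor exactly; the reordering goes into the intertwiner.\<close>

lemma graded_dsum_equiv:
  assumes xs: "\<And>D F. (D, F) \<in> set xs \<Longrightarrow> graded_irred par D F"
    and ys: "\<And>D F. (D, F) \<in> set ys \<Longrightarrow> graded_irred par D F"
    and tr: "\<And>w. w \<noteq> [] \<Longrightarrow> (\<Sum>(D, F)\<leftarrow>xs. mat_trace (word_mat D F (map Some w))) =
      (\<Sum>(D, F)\<leftarrow>ys. mat_trace (word_mat D F (map Some w)))"
  shows "\<exists>zs. list_all2 parity_variant ys zs \<and> equiv_rep (dsum_dim xs) (dsum xs) (dsum_dim zs) (dsum zs)"
  using assms
proof (induction xs arbitrary: ys)
  case Nil
  \<comment> \<open>A leftover block would, with the roles of the lists exchanged, be matched to an
    entry of the empty list.\<close>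
  have "ys = []"
  proof (rule ccontr)
    assume "ys \<noteq> []"
    then obtain D F where "(D, F) \<in> set ys" by (cases ys) auto
    from graded_match[OF Nil(2,1) Nil(3)[symmetric] this] show False by simp
  qed
  thus ?case using equiv_rep_refl[of 0 "\<lambda>g. 0\<^sub>m 0 0"] by (simp add: rep_def)
next
  case (Cons x xs)
  obtain D F where x: "x = (D, F)" by (cases x)
  have "(D, F) \<in> set (x # xs)" using x by simp
  from graded_match[OF Cons.prems this]
  obtain y H where y: "y \<in> set ys" "parity_variant y (D, H)" "equiv_rep D F D H" by blast
  obtain us vs where ys_eq: "ys = us @ y # vs" using y(1) by (meson split_list)
  obtain H0 where H0: "y = (D, H0)" "H = H0 \<or> H = flip_parity H0"
    using y(2) unfolding parity_variant_def by (cases y) auto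
  have gF: "graded_irred par D F" using Cons.prems(1) x by auto
  have gH0: "graded_irred par D H0" using Cons.prems(2) y(1) H0 by auto
  have gH: "graded_irred par D H" using gH0 H0(2) graded_irred_flip by auto
  have W: "word_mat D H (map Some w) = word_mat D H0 (map Some w)" for w
    using H0(2) by (induction w) auto
  \<comment> \<open>Whichever sign was chosen, the partner has the same traces as \<open>F\<close>
    on words in the \<open>A^n\<close>; hence the trace identity passes to the shortened
    lists.\<close>
  have tF: "mat_trace (word_mat D F (map Some w)) = mat_trace (word_mat D H0 (map Some w))" for w
  proof -
    have "mat_trace (poly_mat D H [(1, map Some w)]) = mat_trace (poly_mat D F [(1, map Some w)])"
      using graded_irredD(1)[OF gF] graded_irredD(1)[OF gH] y(3) by (intro equiv_rep_trace)
    thus ?thesis using graded_irredD(1)[OF gF] graded_irredD(1)[OF gH]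
      by (simp add: W mat_trace_add[of _ D] graded_irredD(1)[OF gH0])
  qed
  have "\<exists>zs. list_all2 parity_variant (us @ vs) zs \<and> equiv_rep (dsum_dim xs) (dsum xs) (dsum_dim zs) (dsum zs)"
  proof (rule Cons.IH)
    show "graded_irred par D F" if "(D, F) \<in> set xs" for D F using Cons.prems(1) that by auto
    show "graded_irred par D F" if "(D, F) \<in> set (us @ vs)" for D F using Cons.prems(2) that ys_eq by auto
    fix w :: "'a list" assume "w \<noteq> []"
    from Cons.prems(3)[OF this] tF[of w]
    show "(\<Sum>(D, F)\<leftarrow>xs. mat_trace (word_mat D F (map Some w))) =
      (\<Sum>(D, F)\<leftarrow>us @ vs. mat_trace (word_mat D F (map Some w)))"
      by (simp add: x ys_eq H0)
  qed
  then obtain zs where zs: "list_all2 parity_variant (us @ vs) zs"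
    "equiv_rep (dsum_dim xs) (dsum xs) (dsum_dim zs) (dsum zs)" by auto
  obtain us' vs' where uv: "zs = us' @ vs'" "list_all2 parity_variant us us'" "list_all2 parity_variant vs vs'"
    using zs(1) by (auto simp: list_all2_append1)
  have rz: "rep D F" if z: "(D, F) \<in> set zs" for D F
  proof -
    obtain z where "z \<in> set (us @ vs)" "parity_variant z (D, F)"
      using list_all2_preimage[OF zs(1) z] by blast
    moreover have "graded_irred par (fst z) (snd z)"
      using Cons.prems(2)[of "fst z" "snd z"] \<open>z \<in> set (us @ vs)\<close> ys_eq by auto
    ultimately show ?thesis using graded_irred_flip[of par "fst z" "snd z"] graded_irredD(1)[of par D F]
      unfolding parity_variant_def by auto
  qed
  have rx: "rep (dsum_dim xs) (dsum xs)"
  proof (rule rep_dsum)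
    fix D F assume "(D, F) \<in> set xs"
    hence "graded_irred par D F" using Cons.prems(1) by simp
    thus "rep D F" by (rule graded_irredD(1))
  qed
  have dz: "dsum_dim zs = dsum_dim xs" using zs(2) unfolding equiv_rep_def by simp
  have rzs: "rep (dsum_dim xs) (dsum zs)" using rep_dsum[of zs] rz dz by metis
  have rF: "rep D F" and rH: "rep D H" using graded_irredD(1)[OF gF] graded_irredD(1)[OF gH] by auto
  have e1: "equiv_rep (D + dsum_dim xs) (dsum (x # xs)) (D + dsum_dim xs) (dsum ((D, H) # zs))"
    using equiv_rep_blk[OF rF rH rx rzs y(3)] zs(2) dz x by simp
  \<comment> \<open>Returns the partner to the position of \<open>y\<close>, restoring the alignment
    with \<open>ys\<close>.\<close>
  have mid: "dsum_dim ((D, H) # us' @ vs') = dsum_dim (us' @ (D, H) # vs') \<and>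
    equiv_rep (dsum_dim ((D, H) # us' @ vs')) (dsum ((D, H) # us' @ vs'))
      (dsum_dim (us' @ (D, H) # vs')) (dsum (us' @ (D, H) # vs'))"
    using rz rH uv(1) by (intro dsum_middle) auto
  have d: "dsum_dim (us' @ (D, H) # vs') = D + dsum_dim xs" using mid dz uv(1) by simp
  have e2: "equiv_rep (D + dsum_dim xs) (dsum ((D, H) # zs)) (D + dsum_dim xs) (dsum (us' @ (D, H) # vs'))"
  proof -
    have "dsum_dim (us' @ vs') = dsum_dim xs" using dz uv(1) by simp
    thus ?thesis using conjunct2[OF mid] unfolding d uv(1) by simp
  qed
  have "rep (D + dsum_dim xs) (dsum (us' @ (D, H) # vs'))"
  proof -
    have "rep (dsum_dim (us' @ (D, H) # vs')) (dsum (us' @ (D, H) # vs'))"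
      using rz rH uv(1) by (intro rep_dsum) auto
    thus ?thesis using d by simp
  qed
  hence "equiv_rep (D + dsum_dim xs) (dsum (x # xs)) (D + dsum_dim xs) (dsum (us' @ (D, H) # vs'))"
    using equiv_rep_trans[OF _ _ _ e1 e2] rep_blk[OF rF rx] rep_blk[OF rH rzs] x by simp
  moreover have "list_all2 parity_variant ys (us' @ (D, H) # vs')"
    unfolding ys_eq using uv y(2) by (simp add: list_all2_appendI)
  ultimately show ?case using x d by (intro exI[of _ "us' @ (D, H) # vs'"]) simp
qed

section \<open>Graded canonical forms\<close>

lemma mat_adjoint_mult:
  assumes "A \<in> carrier_mat m n" "B \<in> carrier_mat n k"
  shows "mat_adjoint (A * B) = mat_adjoint B * mat_adjoint (A :: complex mat)"
  using assms by (intro eq_matI)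
    (auto simp: mat_adjoint_alt scalar_prod_def mult.commute intro!: sum.cong)

text \<open>Invariance gives \<open>P Z P = Z P\<close>; as \<open>P\<close> and \<open>Z\<close>
  are Hermitian, the adjoint relation is \<open>P Z P = P Z\<close>.\<close>

lemma projector_commutes:
  assumes P: "orthogonal_projector D W P" and Z: "Z \<in> carrier_mat D D" "mat_adjoint Z = Z"
    and inv: "\<And>w. w \<in> W \<Longrightarrow> Z *\<^sub>v w \<in> W"
  shows "P * Z = Z * P"
proof -
  have Pc: "P \<in> carrier_mat D D" "P * P = P" "mat_adjoint P = P" "(\<lambda>v. P *\<^sub>v v) ` carrier_vec D = W"
    using P unfolding orthogonal_projector_def by auto
  have fix_W: "P *\<^sub>v w = w" if w: "w \<in> W" for w
  proof -
    have "w \<in> (\<lambda>v. P *\<^sub>v v) ` carrier_vec D" using w Pc(4) by simp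
    then obtain v where v: "v \<in> carrier_vec D" "w = P *\<^sub>v v" by (elim imageE)
    thus ?thesis using Pc(2) assoc_mult_mat_vec[OF Pc(1) Pc(1) v(1)] by simp
  qed
  have PZP: "P * (Z * P) = Z * P"
  proof (rule mat_eq_by_vec[OF mult_carrier_mat[OF Pc(1) mult_carrier_mat[OF Z(1) Pc(1)]] mult_carrier_mat[OF Z(1) Pc(1)]])
    fix v :: "complex vec" assume v: "v \<in> carrier_vec D"
    have "P *\<^sub>v v \<in> W" using v Pc(4) by blast
    hence "Z *\<^sub>v (P *\<^sub>v v) \<in> W" by (rule inv)
    thus "(P * (Z * P)) *\<^sub>v v = (Z * P) *\<^sub>v v"
      using assoc_mult_mat_vec[OF Pc(1) mult_carrier_mat[OF Z(1) Pc(1)] v]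
        assoc_mult_mat_vec[OF Z(1) Pc(1) v] fix_W by simp
  qed
  have "P * Z = mat_adjoint (Z * P)"
    unfolding mat_adjoint_mult[OF Z(1) Pc(1)] Z(2) Pc(3) ..
  also have "\<dots> = mat_adjoint (P * (Z * P))" unfolding PZP ..
  also have "\<dots> = mat_adjoint (Z * P) * P"
    unfolding mat_adjoint_mult[OF Pc(1) mult_carrier_mat[OF Z(1) Pc(1)]] Pc(3) ..
  also have "mat_adjoint (Z * P) = P * Z" unfolding mat_adjoint_mult[OF Z(1) Pc(1)] Z(2) Pc(3) ..
  also have "P * Z * P = P * (Z * P)" by (rule assoc_mult_mat[OF Pc(1) Z(1) Pc(1)])
  finally show ?thesis using PZP by simp
qed

lemma lin_subspace_imp_subspace:
  assumes "lin_subspace D W"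
  shows "VectorSpace.subspace class_ring W (module_vec TYPE(complex) D)"
  unfolding VectorSpace.subspace_def submodule_def
  using assms vec_vs vec_module
  by (auto simp: lin_subspace_def module_vec_simps class_ring_simps)

definition graded_family :: "complex \<Rightarrow> ('n \<Rightarrow> complex mat) \<Rightarrow> complex mat \<Rightarrow> 'n option \<Rightarrow> complex mat" where
  "graded_family \<mu> M Z g = (case g of None \<Rightarrow> Z | Some n \<Rightarrow> \<mu> \<cdot>\<^sub>m M n)"

lemma graded_family_simps [simp]:
  "graded_family \<mu> M Z None = Z" "graded_family \<mu> M Z (Some n) = \<mu> \<cdot>\<^sub>m M n"
  by (auto simp: graded_family_def)

text \<open>A zero tensor has a zero transfer matrix, which admits no eigenvalue other than 0,
  whereas the peripheral count demands one of modulus 1.\<close>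

lemma graded_normal_tensor_nonzero:
  assumes "graded_normal_tensor par D M Z"
  shows "\<exists>n. M n \<noteq> 0\<^sub>m D D"
proof (rule ccontr)
  assume no: "\<not> ?thesis"
  let ?E = "transfer_matrix D M"
  have "(\<Sum>e\<in>peripheral_eigenvalues ?E. order e (char_poly ?E)) \<in> {1, 2}"
    using assms unfolding graded_normal_tensor_def Let_def by auto
  hence "peripheral_eigenvalues ?E \<noteq> {}" by auto
  then obtain e where e: "eigenvalue ?E e" "cmod e = 1" unfolding peripheral_eigenvalues_def by auto
  have E: "?E = 0\<^sub>m (D * D) (D * D)"
  proof (rule eq_matI)
    fix i j assume "i < dim_row (0\<^sub>m (D * D) (D * D))" "j < dim_col (0\<^sub>m (D * D) (D * D))"
    hence ij: "i < D * D" "j < D * D" by auto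
    hence "kronecker (M n) (map_mat cnj (M n)) $$ (i, j) = 0" for n
      using no by (simp add: kronecker_def less_mult_imp_div_less)
    thus "?E $$ (i, j) = 0\<^sub>m (D * D) (D * D) $$ (i, j)" using ij by (simp add: transfer_matrix_def)
  qed (auto simp: transfer_matrix_def)
  obtain v where v: "v \<in> carrier_vec (D * D)" "v \<noteq> 0\<^sub>v (D * D)" "?E *\<^sub>v v = e \<cdot>\<^sub>v v"
    using e(1) unfolding eigenvalue_def eigenvector_def E by auto
  have e0: "e \<noteq> 0" using e(2) by auto
  have "v = (1 / e) \<cdot>\<^sub>v (e \<cdot>\<^sub>v v)" using e0 by (simp add: smult_smult_assoc)
  also have "e \<cdot>\<^sub>v v = 0\<^sub>v (D * D)" using v(1,3) unfolding E by simp
  finally show False using v(2) by simp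
qed

text \<open>A subspace invariant under the Hermitian \<open>Z\<close> has an orthogonal projector
  commuting with \<open>Z\<close>, so it is graded. The nonzero factor \<open>\<mu>\<close> changes
  no invariant subspace.\<close>

lemma graded_irred_of_normal:
  assumes G: "graded_normal_tensor par D M Z" and \<mu>: "\<mu> \<noteq> 0"
  shows "graded_irred par D (graded_family \<mu> M Z)"
proof -
  have ev: "even_tensor par D M Z" using G unfolding graded_normal_tensor_def by simp
  have c: "M n \<in> carrier_mat D D" "Z \<in> carrier_mat D D" for n using ev unfolding even_tensor_def by auto
  have Zh: "mat_adjoint Z = Z"
  proof (rule eq_matI)
    fix i j assume "i < dim_row Z" "j < dim_col Z"
    hence ij: "i < D" "j < D" using c by auto
    have "Z $$ (i, i) \<in> {1, -1}" using ev ij unfolding even_tensor_def by auto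
    thus "mat_adjoint Z $$ (i, j) = Z $$ (i, j)"
      using ev ij c unfolding even_tensor_def
      by (cases "i = j") (auto simp: mat_adjoint_alt diagonal_mat_def)
  qed (use c in \<open>auto simp: mat_adjoint_alt\<close>)
  have "even_tensor par D (\<lambda>n. graded_family \<mu> M Z (Some n)) (graded_family \<mu> M Z None)"
  proof -
    have "Z * (\<mu> \<cdot>\<^sub>m M n) = (-1) ^ par n \<cdot>\<^sub>m (\<mu> \<cdot>\<^sub>m M n * Z)" for n
    proof -
      have "Z * M n = (-1) ^ par n \<cdot>\<^sub>m (M n * Z)" using ev unfolding even_tensor_def by simp
      thus ?thesis using mult_smult_distrib[OF c(2) c(1), of \<mu> n] mult_smult_assoc_mat[OF c(1) c(2), of \<mu> n]
        by (simp add: smult_smult_mat mult.commute)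
    qed
    thus ?thesis using ev unfolding even_tensor_def by simp
  qed
  moreover have "\<exists>n. graded_family \<mu> M Z (Some n) \<noteq> 0\<^sub>m D D"
  proof -
    obtain n where n: "M n \<noteq> 0\<^sub>m D D" using graded_normal_tensor_nonzero[OF G] by auto
    have "M n = (1 / \<mu>) \<cdot>\<^sub>m (\<mu> \<cdot>\<^sub>m M n)" using \<mu> by (simp add: smult_smult_mat)
    hence "\<mu> \<cdot>\<^sub>m M n \<noteq> 0\<^sub>m D D" using n by (metis smult_zero_mat)
    thus ?thesis by auto
  qed
  moreover have "W = {0\<^sub>v D} \<or> W = carrier_vec D"
    if W: "lin_subspace D W" "\<forall>g. \<forall>w\<in>W. graded_family \<mu> M Z g *\<^sub>v w \<in> W" for W
  proof -
    have ZW: "Z *\<^sub>v w \<in> W" if "w \<in> W" for w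
    proof -
      have "graded_family \<mu> M Z None *\<^sub>v w \<in> W" using W(2) that by blast
      thus ?thesis by simp
    qed
    have MW: "M n *\<^sub>v w \<in> W" if "w \<in> W" for n w
    proof -
      have "graded_family \<mu> M Z (Some n) *\<^sub>v w \<in> W" using W(2) that by blast
      hence "(1 / \<mu>) \<cdot>\<^sub>v ((\<mu> \<cdot>\<^sub>m M n) *\<^sub>v w) \<in> W" using lin_subspaceD(4)[OF W(1)] by simp
      thus ?thesis using smult_mat_mult_vec[OF c(1) lin_subspaceD(1)[OF W(1) that], of \<mu> n] \<mu>
        by (simp add: smult_smult_assoc)
    qed
    obtain P where P: "orthogonal_projector D W P" using ex_orthogonal_projector[OF W(1)] by auto
    have "graded_subspace D Z W"
      unfolding graded_subspace_def
      using lin_subspace_imp_subspace[OF W(1)] P projector_commutes[OF P c(2) Zh ZW] by blast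
    moreover have "invariant_subspace M W" unfolding invariant_subspace_def using MW by auto
    ultimately show ?thesis using G unfolding graded_normal_tensor_def by blast
  qed
  ultimately show ?thesis unfolding graded_irred_def by blast
qed

lemma dsum_append:
  "dsum_dim (us @ vs) = dsum_dim us + dsum_dim vs"
  "dsum (us @ vs) g = blk (dsum us g) (dsum vs g)"
proof -
  have "blk (0\<^sub>m 0 0) A = A" for A by (intro eq_matI) (auto simp: blk_def)
  thus "dsum (us @ vs) g = blk (dsum us g) (dsum vs g)"
    by (induction us) (auto simp: blk_assoc)
qed (auto simp: dsum_dim_def)

text \<open>The first index of the zero block, \<open>dsum_dim us\<close>, is a vanishing index of
  the whole tensor.\<close>

lemma vanishing_block:
  assumes r: "\<And>D F. (D, F) \<in> set (us @ (d, F0) # vs) \<Longrightarrow> rep D F"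
    and zero: "\<And>n. F0 (Some n) = 0\<^sub>m d d" and d: "0 < d"
  shows "\<not> no_vanishing_index (dsum_dim (us @ (d, F0) # vs)) (\<lambda>n. dsum (us @ (d, F0) # vs) (Some n))"
proof -
  have "rep (dsum_dim us) (dsum us)" "rep (dsum_dim vs) (dsum vs)" using r by (auto intro!: rep_dsum)
  hence c: "dsum us g \<in> carrier_mat (dsum_dim us) (dsum_dim us)"
    "dsum vs g \<in> carrier_mat (dsum_dim vs) (dsum_dim vs)" for g by auto
  let ?a = "dsum_dim us"
  have "dsum (us @ (d, F0) # vs) (Some n) $$ (?a, \<beta>) = 0 \<and> dsum (us @ (d, F0) # vs) (Some n) $$ (\<beta>, ?a) = 0"
    if "\<beta> < dsum_dim (us @ (d, F0) # vs)" for n \<beta>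
    using that d carrier_matD[OF c(1)[of "Some n"]] carrier_matD[OF c(2)[of "Some n"]]
    by (auto simp: dsum_append zero blk_def)
  moreover have "?a < dsum_dim (us @ (d, F0) # vs)" using d by (simp add: dsum_append)
  ultimately show ?thesis unfolding no_vanishing_index_def by blast
qed

text \<open>The weights \<open>\<mu> k\<close> are absorbed into the blocks. A zero weight would
  create a zero block, against the convention on vanishing indices.\<close>

lemma canonical_form_blocks:
  assumes cf: "graded_canonical_form par D A Z" and nv: "no_vanishing_index D A"
  shows "\<exists>xs. (\<forall>(E, F)\<in>set xs. graded_irred par E F) \<and> D = dsum_dim xs \<and>
    (\<forall>n. A n = dsum xs (Some n)) \<and> Z = dsum xs None"
proof -
  obtain r \<mu> Dk Ak Zk where G: "\<And>k. k < r \<Longrightarrow> graded_normal_tensor par (Dk k) (Ak k) (Zk k)"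
    and A: "\<And>n. A n = diag_block_mat (map (\<lambda>k. \<mu> k \<cdot>\<^sub>m Ak k n) [0..<r])"
    and Z: "Z = diag_block_mat (map Zk [0..<r])"
    and ev: "even_tensor par D A Z"
    using cf unfolding graded_canonical_form_def by blast
  define x where "x k = (Dk k, graded_family (\<mu> k) (Ak k) (Zk k))" for k :: nat
  define xs where "xs = map x [0..<r]"
  have A': "A n = dsum xs (Some n)" for n unfolding A xs_def dsum_def x_def by (simp add: comp_def)
  have Z': "Z = dsum xs None" unfolding Z xs_def dsum_def x_def by (simp add: comp_def)
  have rx: "rep E F" if EF: "(E, F) \<in> set xs" for E F
  proof -
    obtain k where k: "k < r" "E = Dk k" "F = graded_family (\<mu> k) (Ak k) (Zk k)"
      using EF unfolding xs_def x_def by auto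
    have "Ak k n \<in> carrier_mat E E" "Zk k \<in> carrier_mat E E" for n
      using G[OF k(1)] k(2) unfolding graded_normal_tensor_def even_tensor_def by auto
    thus ?thesis unfolding rep_def k(3) by (auto simp: graded_family_def split: option.split)
  qed
  have D: "D = dsum_dim xs"
  proof -
    have "rep (dsum_dim xs) (dsum xs)" using rx by (rule rep_dsum)
    hence "Z \<in> carrier_mat (dsum_dim xs) (dsum_dim xs)" unfolding Z' by simp
    moreover have "Z \<in> carrier_mat D D" using ev unfolding even_tensor_def by simp
    ultimately show ?thesis by auto
  qed
  have "\<mu> k \<noteq> 0" if k: "k < r" for k
  proof
    assume \<mu>: "\<mu> k = 0"
    have "[0..<r] = [0..<k] @ [k..<r]" using k by (metis le0 le_Suc_ex less_imp_le upt_add_eq_append)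
    also have "[k..<r] = k # [Suc k..<r]" using k by (rule upt_conv_Cons)
    finally have xs: "xs = map x [0..<k] @ (Dk k, graded_family (\<mu> k) (Ak k) (Zk k)) # map x [Suc k..<r]"
      unfolding xs_def by (simp add: x_def)
    have c: "Ak k n \<in> carrier_mat (Dk k) (Dk k)" for n
      using G[OF k] unfolding graded_normal_tensor_def even_tensor_def by auto
    \<comment> \<open>A zero block contradicts the convention only if it occupies an index; a normal
      tensor, being nonzero, does.\<close>
    have "0 < Dk k"
    proof (rule ccontr)
      assume "\<not> 0 < Dk k"
      hence "Ak k n = 0\<^sub>m (Dk k) (Dk k)" for n using c[of n] by (intro eq_matI) auto
      thus False using graded_normal_tensor_nonzero[OF G[OF k]] by blast
    qed
    moreover have "graded_family (\<mu> k) (Ak k) (Zk k) (Some n) = 0\<^sub>m (Dk k) (Dk k)" for n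
      using \<mu> c[of n] by (intro eq_matI) auto
    ultimately have "\<not> no_vanishing_index (dsum_dim xs) (\<lambda>n. dsum xs (Some n))"
      using rx unfolding xs by (intro vanishing_block)
    thus False using nv unfolding D A'[symmetric] by simp
  qed
  hence "graded_irred par E F" if "(E, F) \<in> set xs" for E F
    using that G unfolding xs_def x_def by (auto intro!: graded_irred_of_normal)
  thus ?thesis using D A' Z' by blast
qed

text \<open>Parity variants differ only in the component at \<open>None\<close>, so replacing
  \<open>ys\<close> by its variants leaves the matrices of the second tensor untouched.\<close>

lemma dsum_parity_variant:
  assumes "list_all2 parity_variant xs ys" "\<forall>(D, F)\<in>set xs. graded_irred par D F"
  shows "dsum_dim ys = dsum_dim xs \<and> (\<forall>n. dsum ys (Some n) = dsum xs (Some n)) \<and>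
    (\<forall>(D, F)\<in>set ys. graded_irred par D F)"
  using assms
proof (induction rule: list_all2_induct)
  case (Cons x xs y ys)
  obtain D F where x: "x = (D, F)" by (cases x)
  have "graded_irred par D F" using Cons.prems x by simp
  thus ?case using Cons x graded_irred_flip[of par D F] unfolding parity_variant_def by auto
qed simp

lemma dsum_diagonal_signs:
  assumes "\<forall>(D, F)\<in>set xs. graded_irred par D F"
  shows "diagonal_mat (dsum xs None) \<and> (\<forall>i<dsum_dim xs. dsum xs None $$ (i, i) \<in> {1, -1})"
  using assms
proof (induction xs)
  case (Cons x xs)
  obtain D F where x: "x = (D, F)" by (cases x)
  have F: "graded_irred par D F" using Cons.prems x by simp
  note G = graded_irredD[OF F]
  have "rep (dsum_dim xs) (dsum xs)"
  proof (rule rep_dsum)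
    fix D F assume "(D, F) \<in> set xs"
    thus "rep D F" using Cons.prems graded_irredD(1)[of par D F] by auto
  qed
  hence c: "dsum xs None \<in> carrier_mat (dsum_dim xs) (dsum_dim xs)" "F None \<in> carrier_mat D D" using G(1) by auto
  have IH: "diagonal_mat (dsum xs None)" "\<And>i. i < dsum_dim xs \<Longrightarrow> dsum xs None $$ (i, i) \<in> {1, -1}"
    using Cons by auto
  have IH': "dsum xs None $$ (i - D, i - D) \<in> {1, -1}" if "i < D + dsum_dim xs" "\<not> i < D" for i
    using that by (intro IH(2)) auto
  have "diagonal_mat (blk (F None) (dsum xs None))"
    using IH(1) G(3) carrier_matD[OF c(1)] carrier_matD[OF c(2)] unfolding diagonal_mat_def blk_def by auto
  moreover have "blk (F None) (dsum xs None) $$ (i, i) \<in> {1, -1}" if "i < D + dsum_dim xs" for i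
    using that IH'[OF that] G(4)[of i] carrier_matD[OF c(1)] carrier_matD[OF c(2)] unfolding blk_def by auto
  ultimately show ?case using x by simp
qed (simp add: diagonal_mat_def)

text \<open>The size fixes the sum of the multiplicities of 1 and -1, and the total fixes their
  difference.\<close>

lemma sign_mset_eq:
  fixes M N :: "complex multiset"
  assumes M: "\<forall>x\<in>#M. x \<in> {1, -1}" and N: "\<forall>x\<in>#N. x \<in> {1, -1}"
    and size: "size M = size N" and sum: "sum_mset M = sum_mset N"
  shows "M = N"
proof -
  have split: "\<exists>p q. K = replicate_mset p 1 + replicate_mset q (-1)"
    if "\<forall>x\<in>#K. x \<in> {1, -1}" for K :: "complex multiset" using that
  proof (induction K)
    case empty
    show ?case by (rule exI[of _ 0], rule exI[of _ 0]) simp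
  next
    case (add x K)
    then obtain p q where K: "K = replicate_mset p 1 + replicate_mset q (-1)" by auto
    show ?case
    proof (cases "x = 1")
      case True
      thus ?thesis using K by (intro exI[of _ "Suc p"] exI[of _ q]) simp
    next
      case False
      hence "x = -1" using add.prems by auto
      thus ?thesis using K by (intro exI[of _ p] exI[of _ "Suc q"]) simp
    qed
  qed
  obtain p q where pq: "M = replicate_mset p 1 + replicate_mset q (-1)" using split[OF M] by auto
  obtain p' q' where pq': "N = replicate_mset p' 1 + replicate_mset q' (-1)" using split[OF N] by auto
  have "p + q = p' + q'" using size by (simp add: pq pq')
  moreover have "(of_nat p - of_nat q :: complex) = of_nat p' - of_nat q'" using sum by (simp add: pq pq')
  hence "(of_nat (p + q') :: complex) = of_nat (p' + q)" by (simp add: algebra_simps)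
  hence "p + q' = p' + q" by (simp only: of_nat_eq_iff)
  ultimately have "p = p'" "q = q'" by linarith+
  thus ?thesis by (simp add: pq pq')
qed

text \<open>Dimension and trace determine how often each sign occurs on the diagonal, and two
  diagonals with the same multiset of entries differ by a permutation of the indices.\<close>

lemma ex_permutation_conjugating_signs:
  assumes Y: "Y \<in> carrier_mat D D" "diagonal_mat Y" "\<forall>i<D. Y $$ (i, i) \<in> {1, -1}"
    and Z: "Z \<in> carrier_mat D D" "diagonal_mat Z" "\<forall>i<D. Z $$ (i, i) \<in> {1, -1}"
    and tr: "mat_trace Y = mat_trace Z"
  shows "\<exists>P P'. permutation_matrix D P \<and> inverse_matrices D P P' \<and> Z * P = P * Y"
proof -
  have "image_mset (\<lambda>i. Y $$ (i, i)) (mset_set {..<D}) = image_mset (\<lambda>i. Z $$ (i, i)) (mset_set {..<D})"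
    using Y Z tr unfolding mat_trace_def by (intro sign_mset_eq) (auto simp: sum_unfold_sum_mset)
  then obtain \<pi> where \<pi>: "\<pi> permutes {..<D}" "\<forall>j\<in>{..<D}. Y $$ (j, j) = Z $$ (\<pi> j, \<pi> j)"
    by (rule image_mset_eq_implies_permutes[rotated]) auto
  \<comment> \<open>Sends basis vector \<open>j\<close> to basis vector \<open>\<pi> j\<close>; its
    transpose is its inverse.\<close>
  define P :: "complex mat" where "P = mat D D (\<lambda>(i, j). if i = \<pi> j then 1 else 0)"
  have P: "P \<in> carrier_mat D D" unfolding P_def by simp
  have \<pi>D: "\<pi> j < D" if "j < D" for j using permutes_in_image[OF \<pi>(1), of j] that by simp
  have inj: "\<pi> i = \<pi> j \<longleftrightarrow> i = j" for i j using permutes_inj[OF \<pi>(1)] by (auto dest: injD)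
  have PP: "P\<^sup>T * P = 1\<^sub>m D"
  proof (rule eq_matI)
    fix i j assume "i < dim_row (1\<^sub>m D)" "j < dim_col (1\<^sub>m D)"
    hence ij: "i < D" "j < D" by auto
    have "(P\<^sup>T * P) $$ (i, j) = (\<Sum>k<D. (if k = \<pi> i then 1 else 0) * (if k = \<pi> j then 1 else 0))"
      using ij unfolding P_def by (auto simp: scalar_prod_def atLeast0LessThan intro!: sum.cong)
    also have "\<dots> = (\<Sum>k<D. if k = \<pi> i then (if i = j then 1 else 0) else 0)"
      by (intro sum.cong) (auto simp: inj)
    also have "\<dots> = 1\<^sub>m D $$ (i, j)" using ij \<pi>D by (simp add: sum.delta)
    finally show "(P\<^sup>T * P) $$ (i, j) = 1\<^sub>m D $$ (i, j)" .
  qed (use P in auto)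
  have "P * P\<^sup>T = 1\<^sub>m D" using mat_mult_left_right_inverse[OF _ P PP] P by simp
  hence "inverse_matrices D P P\<^sup>T" using P PP by (intro inverse_matricesI) auto
  moreover have "permutation_matrix D P" unfolding permutation_matrix_def P_def using \<pi>(1) by blast
  moreover have "Z * P = P * Y"
  proof (rule eq_matI)
    fix i j assume "i < dim_row (P * Y)" "j < dim_col (P * Y)"
    hence ij: "i < D" "j < D" using P Y by auto
    have "(Z * P) $$ (i, j) = (\<Sum>k<D. Z $$ (i, k) * (if k = \<pi> j then 1 else 0))"
      using ij Z(1) unfolding P_def by (auto simp: scalar_prod_def atLeast0LessThan intro!: sum.cong)
    also have "\<dots> = (\<Sum>k<D. if k = \<pi> j then Z $$ (i, \<pi> j) else 0)" by (intro sum.cong) auto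
    also have "\<dots> = Z $$ (i, \<pi> j)" using \<pi>D[OF ij(2)] by (simp add: sum.delta)
    also have "\<dots> = (if i = \<pi> j then 1 else 0) * Y $$ (j, j)"
      using Z(1,2) \<pi>(2) \<pi>D[OF ij(2)] ij unfolding diagonal_mat_def by auto
    also have "\<dots> = (\<Sum>k<D. if k = j then (if i = \<pi> j then 1 else 0) * Y $$ (j, j) else 0)"
      using ij by (simp add: sum.delta)
    also have "\<dots> = (\<Sum>k<D. (if i = \<pi> k then 1 else 0) * Y $$ (k, j))"
      using Y(1,2) ij unfolding diagonal_mat_def by (intro sum.cong) auto
    also have "\<dots> = (P * Y) $$ (i, j)"
      using ij Y(1) unfolding P_def by (auto simp: scalar_prod_def atLeast0LessThan intro!: sum.cong)
    finally show "(Z * P) $$ (i, j) = (P * Y) $$ (i, j)" .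
  qed (use P Y Z in auto)
  ultimately show ?thesis by blast
qed

section \<open>Chain coefficients as block traces, and assembly of the gauge matrix\<close>

lemma fMPS_apbc_dsum:
  assumes "\<forall>(D, F)\<in>set xs. graded_irred par D F" "\<And>n. A n = dsum xs (Some n)"
  shows "fMPS_apbc (dsum_dim xs) A (length w) w = (\<Sum>(D, F)\<leftarrow>xs. mat_trace (word_mat D F (map Some w)))"
proof -
  have "foldr (\<lambda>n M. A n * M) w (1\<^sub>m (dsum_dim xs)) = word_mat (dsum_dim xs) (dsum xs) (map Some w)"
    by (induction w) (auto simp: assms(2))
  moreover have "rep D F" if "(D, F) \<in> set xs" for D F
    using assms(1) that graded_irredD(1)[of par D F] by auto
  ultimately show ?thesis using trace_word_dsum[of xs "map Some w"] by (simp add: fMPS_apbc_def)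
qed

theorem mainTheorem6:
  fixes par :: "'n::finite \<Rightarrow> nat"
    and Da Db :: nat
    and A B :: "'n \<Rightarrow> complex mat"
    and Za Zb :: "complex mat"
  assumes "\<forall>n. par n \<in> {0, 1}"
    and "graded_canonical_form par Da A Za" and "no_vanishing_index Da A"
    and "graded_canonical_form par Db B Zb" and "no_vanishing_index Db B"
    and "\<forall>N\<ge>1. fMPS_apbc Da A N = fMPS_apbc Db B N"
  shows "Da = Db \<and>
    (\<exists>X X' P P'. inverse_matrices Da X X' \<and>
       permutation_matrix Da P \<and> inverse_matrices Da P P' \<and>
       (\<forall>i. A i = X * P * B i * P' * X') \<and>
       X * Za = Za * X)"
proof -
  obtain xs where xs: "\<forall>(E, F)\<in>set xs. graded_irred par E F" "Da = dsum_dim xs"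
    "\<And>n. A n = dsum xs (Some n)" "Za = dsum xs None"
    using canonical_form_blocks[OF assms(2,3)] by blast
  obtain ys where ys: "\<forall>(E, F)\<in>set ys. graded_irred par E F" "Db = dsum_dim ys"
    "\<And>n. B n = dsum ys (Some n)"
    using canonical_form_blocks[OF assms(4,5)] by blast
  have tr: "(\<Sum>(D, F)\<leftarrow>xs. mat_trace (word_mat D F (map Some w))) =
    (\<Sum>(D, F)\<leftarrow>ys. mat_trace (word_mat D F (map Some w)))" if "w \<noteq> []" for w :: "'n list"
  proof -
    have "1 \<le> length w" using that by (cases w) auto
    hence "fMPS_apbc Da A (length w) w = fMPS_apbc Db B (length w) w" using assms(6) by simp
    thus ?thesis
      unfolding xs(2) ys(2) fMPS_apbc_dsum[where A = A, OF xs(1,3)] fMPS_apbc_dsum[where A = B, OF ys(1,3)] .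
  qed
  have gx: "graded_irred par D F" if "(D, F) \<in> set xs" for D F using xs(1) that by auto
  have gy: "graded_irred par D F" if "(D, F) \<in> set ys" for D F using ys(1) that by auto
  obtain zs where zs: "list_all2 parity_variant ys zs"
    "equiv_rep (dsum_dim xs) (dsum xs) (dsum_dim zs) (dsum zs)"
    using graded_dsum_equiv[OF gx gy tr] by blast
  have z: "dsum_dim zs = dsum_dim ys" "\<And>n. dsum zs (Some n) = dsum ys (Some n)"
    "\<forall>(D, F)\<in>set zs. graded_irred par D F"
    using dsum_parity_variant[OF zs(1) ys(1)] by auto
  have dim: "Da = Db" using zs(2) z(1) xs(2) ys(2) unfolding equiv_rep_def by simp
  obtain T T' where T: "inverse_matrices Da T T'" "\<And>g. dsum xs g * T = T * dsum zs g"
    using zs(2) xs(2) unfolding equiv_rep_def by auto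
  note Ti = inverse_matricesD[OF T(1)]
  have rx: "rep Da (dsum xs)" unfolding xs(2)
  proof (rule rep_dsum)
    show "rep D F" if "(D, F) \<in> set xs" for D F by (rule graded_irredD(1)[OF gx[OF that]])
  qed
  have rz: "rep Da (dsum zs)" unfolding dim ys(2) z(1)[symmetric]
  proof (rule rep_dsum)
    show "rep D F" if "(D, F) \<in> set zs" for D F
      using z(3) that graded_irredD(1)[of par D F] by auto
  qed
  \<comment> \<open>The parity of the second tensor with the signs of some blocks possibly reversed.
    It is \<open>Y\<close>, not necessarily \<open>Zb\<close>, that \<open>T\<close> carries to
    \<open>Za\<close>, so the permutation is built from \<open>Y\<close>.\<close>
  define Y where "Y = dsum zs None"
  have c: "A n \<in> carrier_mat Da Da" "B n \<in> carrier_mat Da Da" "Za \<in> carrier_mat Da Da" "Y \<in> carrier_mat Da Da" for n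
    unfolding xs(3,4) ys(3) Y_def using rx rz z(2) by (metis repD)+
  have TA: "A n * T = T * B n" for n using T(2)[of "Some n"] z(2) xs(3) ys(3) by simp
  have TZ: "Za * T = T * Y" using T(2)[of None] xs(4) Y_def by simp
  \<comment> \<open>Similar matrices have equal traces, the invariant that compares the two diagonal
    sign matrices.\<close>
  have "mat_trace Y = mat_trace (T' * (T * Y))"
    using assoc_mult_mat[OF Ti(2,1) c(4)] Ti(4) left_mult_one_mat[OF c(4)] by simp
  also have "\<dots> = mat_trace (Za * T * T')"
    unfolding TZ[symmetric] by (rule mat_trace_comm[OF Ti(2) mult_carrier_mat[OF c(3) Ti(1)]])
  also have "Za * T * T' = Za"
    using assoc_mult_mat[OF c(3) Ti(1,2)] Ti(3) right_mult_one_mat[OF c(3)] by simp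
  finally have trace: "mat_trace Y = mat_trace Za" .
  have "\<exists>P P'. permutation_matrix Da P \<and> inverse_matrices Da P P' \<and> Za * P = P * Y"
    using dsum_diagonal_signs[OF xs(1)] dsum_diagonal_signs[OF z(3)] c(3,4) trace z(1)
    unfolding xs(4) Y_def dim ys(2) xs(2)[symmetric]
    by (intro ex_permutation_conjugating_signs) (auto simp: dim ys(2) simp flip: xs(2))
  then obtain P P' where P: "permutation_matrix Da P" "inverse_matrices Da P P'" "Za * P = P * Y" by blast
  note Pi = inverse_matricesD[OF P(2)]
  note assoc = assoc_mult_mat[of _ Da Da _ Da _ Da]
  have P'Z: "P' * Za = Y * P'"
  proof -
    have "P' * Za = P' * (Za * (P * P'))" using Pi(3) c(3) by simp
    also have "Za * (P * P') = Za * P * P'" using c(3) Pi by (simp add: assoc)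
    also have "P' * (Za * P * P') = P' * P * (Y * P')" unfolding P(3) using c(4) Pi(1,2) by (simp add: assoc)
    also have "\<dots> = Y * P'" unfolding Pi(4) using c(4) Pi(2) by (simp add: left_mult_one_mat[of _ Da Da])
    finally show ?thesis .
  qed
  \<comment> \<open>The gauge matrix is \<open>X = T * P'\<close>: conjugation by \<open>P'\<close>
    takes \<open>Za\<close> to \<open>Y\<close>, and conjugation by \<open>T\<close> takes
    \<open>Y\<close> back to \<open>Za\<close>.\<close>
  have inv: "inverse_matrices Da (T * P') (P * T')"
  proof (rule inverse_matricesI)
    have "T * P' * (P * T') = T * (P' * P * T')" using Ti(1,2) Pi(1,2) by (simp add: assoc)
    also have "\<dots> = 1\<^sub>m Da" unfolding Pi(4) using Ti by (simp add: left_mult_one_mat[of _ Da Da])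
    finally show "T * P' * (P * T') = 1\<^sub>m Da" .
    have "P * T' * (T * P') = P * (T' * T * P')" using Ti(1,2) Pi(1,2) by (simp add: assoc)
    also have "\<dots> = 1\<^sub>m Da" unfolding Ti(4) using Pi by (simp add: left_mult_one_mat[of _ Da Da])
    finally show "P * T' * (T * P') = 1\<^sub>m Da" .
  qed (use Ti Pi in auto)
  \<comment> \<open>In the product of \<open>X\<close> and \<open>P\<close> the permutation cancels,
    leaving conjugation of \<open>B i\<close> by \<open>T\<close>.\<close>
  have "A i = T * P' * P * B i * P' * (P * T')" for i
  proof -
    have "T * P' * P * B i * P' * (P * T') = T * (P' * P) * B i * (P' * P) * T'"
      using Ti(1,2) Pi(1,2) c(2)[of i] by (simp add: assoc)
    also have "\<dots> = T * B i * T'"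
      unfolding Pi(4) using Ti(1,2) c(2)[of i] by (simp add: right_mult_one_mat[of _ Da Da])
    also have "\<dots> = A i * (T * T')" unfolding TA[symmetric] using Ti(1,2) c(1)[of i] by (simp add: assoc)
    also have "\<dots> = A i" unfolding Ti(3) using c(1)[of i] by simp
    finally show ?thesis by simp
  qed
  moreover have "T * P' * Za = Za * (T * P')"
  proof -
    have "T * P' * Za = T * (P' * Za)" using Ti(1) Pi(2) c(3) by (simp add: assoc)
    also have "\<dots> = T * Y * P'" unfolding P'Z using Ti(1) Pi(2) c(4) by (simp add: assoc)
    also have "\<dots> = Za * (T * P')" unfolding TZ[symmetric] using Ti(1) Pi(2) c(3) by (simp add: assoc)
    finally show ?thesis .
  qed
  ultimately show ?thesis using dim inv P(1,2) by blast
qed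

end
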